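(* Let $\{\bm{X}_h\}_h$, $\bm{X}_h = \bm{V}_h\times \bm{W}_h\times Q_h$ with $\bm{V}_h\subset \bm{V}$, $\bm{W}_h\subset \bm{W}$, $Q_h\subset Q$, be a family of finite-element spaces (indexed by the mesh size $h$) that is Stokes-Biot stable, that is, (i) there exists $C_{\bm{V}}>0$ such that $a(\bm{u},\bm{v})\le C_{\bm{V}}\|\bm{u}\|_1\|\bm{v}\|_1$ for all $\bm{u},\bm{v}\in\bm{V}_h$; (ii) there exists $\alpha_{\bm{V}}>0$ such that $a(\bm{u},\bm{u})\ge \alpha_{\bm{V}}\|\bm{u}\|_1^2$ for all $\bm{u}\in\bm{V}_h$; (iii) the pair $(\bm{W}_h,Q_h)$ is Poisson stable; (iv) the pair $(\bm{V}_h,Q_h)$ is Stokes stable. For $\bm{x}=(\bm{u},\bm{w},p)\in\bm{X}_h$ and $\bm{y}=(\bm{v},\bm{r},q)\in\bm{X}_h$ define $$\mathcal{B}(\bm{x},\bm{y}) = a^{\mathrm{RQ}}(\bm{u},\bm{v}) - (\alpha p,\operatorname{div}\bm{v}) + \tau(\bm{K}^{-1}\mu_f\bm{w},\bm{r}) - \tau(p,\operatorname{div}\bm{r}) - \tau(\operatorname{div}\bm{w},q) - \Big(\tfrac1M p,q\Big) - (\alpha\operatorname{div}\bm{u},q),$$ $$\|\bm{x}\|_{\mathcal{D}^{\mathrm{RQ}}}^2 = \|\bm{u}\|_{A_{\bm{u}}^{\mathrm{RQ}}}^2 + c_p^{-1}\|p\|^2 + \tau\|\bm{w}\|_{M_{\bm{w}}}^2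 + \tau^2 c_p\|\operatorname{div}\bm{w}\|^2,$$ where $\|\bm{u}\|_{A_{\bm{u}}^{\mathrm{RQ}}}^2 = a^{\mathrm{RQ}}(\bm{u},\bm{u})$, $\|\bm{w}\|_{M_{\bm{w}}}^2 = (\bm{K}^{-1}\mu_f\bm{w},\bm{w})$, $c_p = \big(\frac{\alpha^2}{\zeta^2}+\frac1M\big)^{-1}$ and $\zeta=\sqrt{\lambda+2\mu/d}$. Then there exist constants $\tilde\varsigma>0$ and $\tilde\gamma>0$, independent of the physical parameters ($\lambda,\mu,\alpha,M,\mu_f,\bm{K}$) and of the discretization parameters ($h,\tau$), such that $$\sup_{\bm{0}\ne\bm{x}\in\bm{X}_h}\ \sup_{\bm{0}\ne\bm{y}\in\bm{X}_h}\frac{\mathcal{B}(\bm{x},\bm{y})}{\|\bm{x}\|_{\mathcal{D}^{\mathrm{RQ}}}\|\bm{y}\|_{\mathcal{D}^{\mathrm{RQ}}}}\le\tilde\varsigma,\qquad \inf_{\bm{0}\ne\bm{y}\in\bm{X}_h}\ \sup_{\bm{0}\ne\bm{x}\in\bm{X}_h}\frac{\mathcal{B}(\bm{x},\bm{y})}{\|\bm{x}\|_{\mathcal{D}^{\mathrm{RQ}}}\|\bm{y}\|_{\mathcal{D}^{\mathrm{RQ}}}}\ge\tilde\gamma.$$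
   Context: Setting: $\Omega\subset\mathbb{R}^d$, $d\in\{2,3\}$, is a bounded domain with sufficiently smooth boundary $\Gamma$; $\Gamma_t,\Gamma_c$ are relatively open subsets of $\Gamma$ of nonzero measure with $\Gamma=\bar\Gamma_t\cup\bar\Gamma_c$. $(\cdot,\cdot)$ and $\|\cdot\|$ are the $L^2(\Omega)$ inner product and norm (for scalar-, vector- or tensor-valued functions), and $\|\cdot\|_1$ is the $\bm{H}^1(\Omega)$ norm. The continuous spaces are $\bm{V}=\{\bm{u}\in\bm{H}^1(\Omega): \bm{u}|_{\bar\Gamma_c}=\bm{0}\}$, $Q=L^2(\Omega)$, $\bm{W}=\{\bm{w}\in\bm{H}(\operatorname{div},\Omega): (\bm{w}\cdot\bm{n})|_{\Gamma_c}=0\}$, with $\bm{n}$ the outward unit normal. Parameters: Lamé coefficients $\mu>0$, $\lambda\ge0$; Biot–Willis constant $\alpha>0$; Biot modulus $M>0$; fluid viscosity $\mu_f>0$; symmetric positive definite permeability tensor $\bm{K}$; time step $\tau>0$. Forms: $\varepsilon(\bm{u})=\frac12(\nabla\bm{u}+\nabla\bm{u}^\top)$; $a(\bm{u},\bm{v})=2\mu(\varepsilon(\bm{u}),\varepsilon(\bm{v}))+\lambda(\operatorname{div}\bm{u},\operatorname{div}\bm{v})$; the reduced-quadrature form is $a^{\mathrm{RQ}}(\bm{u},\bm{v})=2\mu(\varepsilon(\bm{u}),\varepsilon(\bm{v}))+\lambda(P_{Q_h}\operatorname{div}\bm{u},P_{Q_h}\operatorname{div}\bm{v})$, where $P_{Q_h}$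 is the $L^2$-orthogonal projection from $Q$ onto $Q_h$. (In the paper's discretization $\bm{V}_h$ is the space of continuous piecewise linear vector fields enriched with face-normal bubble functions, $\bm{W}_h$ the lowest-order Raviart–Thomas space, and $Q_h$ the piecewise constants.) Stokes stable: there is $\gamma_B^0>0$ independent of the mesh size with $\sup_{\bm{0}\neq\bm{v}\in\bm{V}_h}\frac{(\operatorname{div}\bm{v},p)}{\|\bm{v}\|_1}\ge\gamma_B^0\|p\|$ for all $p\in Q_h$. Poisson stable: $(\bm{W}_h,Q_h)$ satisfies the stability and continuity conditions for the mixed formulation of Poisson's equation, uniformly in $h$: $\operatorname{div}\bm{W}_h\subset Q_h$; the forms $(\bm{w},\bm{r})$ and $(\operatorname{div}\bm{w},q)$ are bounded with respect to the $\bm{H}(\operatorname{div})$ and $L^2$ norms; $(\bm{w},\bm{w})$ is coercive in the $\bm{H}(\operatorname{div})$ norm on $\{\bm{w}\in\bm{W}_h:(\operatorname{div}\bm{w},q)=0\ \forall q\in Q_h\}$; and there is $\gamma_P>0$ independent of $h$ with $\sup_{\bm{0}\ne\bm{w}\in\bm{W}_h}\frac{(\operatorname{div}\bm{w},q)}{\|\bm{w}\|_{\bm{H}(\operatorname{div})}}\ge\gamma_P\|q\|$ for all $q\in Q_h$. The constants $C_{\bm{V}}$ and $\alpha_{\bm{V}}$ in (i)–(ii) may depend on $\lambda,\mu$. *)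

theory Defs
  imports "HOL-Analysis.Analysis"
begin

section \<open>Surface measure and the domain\<close>

definition hausdorff_outer :: "nat \<Rightarrow> ('a::euclidean_space) set \<Rightarrow> ennreal" where
  "hausdorff_outer s A =
    (SUP \<delta>\<in>{0<..}. INF U\<in>{U :: nat \<Rightarrow> 'a set. A \<subseteq> (\<Union>n. U n) \<and> (\<forall>n. bounded (U n) \<and> diameter (U n) \<le> \<delta>)}.
       (\<Sum>n. ennreal (unit_ball_vol (real s) * (diameter (U n) / 2) ^ s)))"

text \<open>The \<open>(d-1)\<close>-dimensional Hausdorff measure on the Borel sets, normalised so that it agrees
  with Lebesgue measure on hyperplanes; it is a measure there since \<open>hausdorff_outer\<close> is a metric
  outer measure. It is only used for \<open>d \<ge> 2\<close>; empty sets in a cover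
  then contribute \<open>0\<close>.\<close>

definition surface_measure :: "(real^'d) measure" where
  "surface_measure = measure_of UNIV (sets borel) (hausdorff_outer (CARD('d) - 1))"

text \<open>Near each boundary point the domain is the epigraph of a Lipschitz function over the
  hyperplane orthogonal to some unit vector \<open>e\<close>.\<close>

definition lipschitz_boundary :: "(real^'d) set \<Rightarrow> bool" where
  "lipschitz_boundary \<Omega> \<longleftrightarrow>
    (\<forall>z\<in>frontier \<Omega>. \<exists>r>0. \<exists>e L. \<exists>g :: real^'d \<Rightarrow> real.
       norm e = 1 \<and> L-lipschitz_on UNIV g \<and>
       \<Omega> \<inter> ball z r = {x \<in> ball z r. g (x - (x \<bullet> e) *\<^sub>R e) < x \<bullet> e})"

definition poro_domain :: "(real^'d) set \<Rightarrow> (real^'d) set \<Rightarrow> (real^'d) set \<Rightarrow> bool" where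
  "poro_domain \<Omega> \<Gamma>t \<Gamma>c \<longleftrightarrow>
     open \<Omega> \<and> connected \<Omega> \<and> \<Omega> \<noteq> {} \<and> bounded \<Omega> \<and> lipschitz_boundary \<Omega> \<and>
     openin (top_of_set (frontier \<Omega>)) \<Gamma>t \<and> openin (top_of_set (frontier \<Omega>)) \<Gamma>c \<and>
     0 < emeasure surface_measure \<Gamma>t \<and> 0 < emeasure surface_measure \<Gamma>c \<and>
     frontier \<Omega> = closure \<Gamma>t \<union> closure \<Gamma>c"


section \<open>Lebesgue spaces\<close>

text \<open>Elements of function spaces are represented by functions on the whole of
  \<open>real^'d\<close>, of which only the values almost everywhere on \<open>\<Omega>\<close> matter. In particular, an
  element is zero when it vanishes almost everywhere on \<open>\<Omega>\<close>.\<close>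

definition ae_zero :: "(real^'d) set \<Rightarrow> (real^'d \<Rightarrow> 'b::euclidean_space) \<Rightarrow> bool" where
  "ae_zero \<Omega> f \<longleftrightarrow> (AE x in lebesgue_on \<Omega>. f x = 0)"

definition L2 :: "(real^'d) set \<Rightarrow> (real^'d \<Rightarrow> 'b::euclidean_space) set" where
  "L2 \<Omega> = {f \<in> borel_measurable (lebesgue_on \<Omega>). integrable (lebesgue_on \<Omega>) (\<lambda>x. (norm (f x))\<^sup>2)}"

definition ip :: "(real^'d) set \<Rightarrow> (real^'d \<Rightarrow> 'b::euclidean_space) \<Rightarrow> (real^'d \<Rightarrow> 'b) \<Rightarrow> real" where
  "ip \<Omega> f g = (\<integral>x. f x \<bullet> g x \<partial>lebesgue_on \<Omega>)"

definition nrm :: "(real^'d) set \<Rightarrow> (real^'d \<Rightarrow> 'b::euclidean_space) \<Rightarrow> real" where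
  "nrm \<Omega> f = sqrt (ip \<Omega> f f)"


section \<open>Weak derivatives and Sobolev spaces\<close>

definition nabla :: "(real^'d \<Rightarrow> real) \<Rightarrow> real^'d \<Rightarrow> real^'d" where
  "nabla \<phi> x = (\<chi> i. frechet_derivative \<phi> (at x) (axis i 1))"

primrec Ck :: "nat \<Rightarrow> (real^'d \<Rightarrow> real) \<Rightarrow> bool" where
  "Ck 0 f = continuous_on UNIV f"
| "Ck (Suc k) f = ((\<forall>x. f differentiable (at x)) \<and> (\<forall>i. Ck k (\<lambda>x. nabla f x $ i)))"

definition smooth :: "(real^'d \<Rightarrow> real) \<Rightarrow> bool" where
  "smooth f \<longleftrightarrow> (\<forall>k. Ck k f)"

definition test_fun :: "(real^'d) set \<Rightarrow> (real^'d \<Rightarrow> real) \<Rightarrow> bool" where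
  "test_fun \<Omega> \<phi> \<longleftrightarrow> smooth \<phi> \<and> compact (closure {x. \<phi> x \<noteq> 0}) \<and> closure {x. \<phi> x \<noteq> 0} \<subseteq> \<Omega>"

definition weak_grad :: "(real^'d) set \<Rightarrow> (real^'d \<Rightarrow> real) \<Rightarrow> (real^'d \<Rightarrow> real^'d) \<Rightarrow> bool" where
  "weak_grad \<Omega> f g \<longleftrightarrow>
    (\<forall>\<phi> i. test_fun \<Omega> \<phi> \<longrightarrow> ip \<Omega> f (\<lambda>x. nabla \<phi> x $ i) = - ip \<Omega> (\<lambda>x. g x $ i) \<phi>)"

definition weak_div :: "(real^'d) set \<Rightarrow> (real^'d \<Rightarrow> real^'d) \<Rightarrow> (real^'d \<Rightarrow> real) \<Rightarrow> bool" where
  "weak_div \<Omega> w g \<longleftrightarrow> (\<forall>\<phi>. test_fun \<Omega> \<phi> \<longrightarrow> ip \<Omega> w (nabla \<phi>) = - ip \<Omega> g \<phi>)"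

definition H1 :: "(real^'d) set \<Rightarrow> (real^'d \<Rightarrow> real) set" where
  "H1 \<Omega> = {f \<in> L2 \<Omega>. \<exists>g\<in>L2 \<Omega>. weak_grad \<Omega> f g}"

definition H1v :: "(real^'d) set \<Rightarrow> (real^'d \<Rightarrow> real^'d) set" where
  "H1v \<Omega> = {u. \<forall>i. (\<lambda>x. u x $ i) \<in> H1 \<Omega>}"

definition Hdiv :: "(real^'d) set \<Rightarrow> (real^'d \<Rightarrow> real^'d) set" where
  "Hdiv \<Omega> = {w \<in> L2 \<Omega>. \<exists>g\<in>L2 \<Omega>. weak_div \<Omega> w g}"

text \<open>Weak derivatives are unique up to null sets, so choosing a representative is harmless.\<close>

definition grad :: "(real^'d) set \<Rightarrow> (real^'d \<Rightarrow> real) \<Rightarrow> real^'d \<Rightarrow> real^'d" where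
  "grad \<Omega> f = (SOME g. g \<in> L2 \<Omega> \<and> weak_grad \<Omega> f g)"

definition dvg :: "(real^'d) set \<Rightarrow> (real^'d \<Rightarrow> real^'d) \<Rightarrow> real^'d \<Rightarrow> real" where
  "dvg \<Omega> w = (SOME g. g \<in> L2 \<Omega> \<and> weak_div \<Omega> w g)"

definition jac :: "(real^'d) set \<Rightarrow> (real^'d \<Rightarrow> real^'d) \<Rightarrow> real^'d \<Rightarrow> real^'d^'d" where
  "jac \<Omega> u x = (\<chi> i. grad \<Omega> (\<lambda>y. u y $ i) x)"

definition strain :: "(real^'d) set \<Rightarrow> (real^'d \<Rightarrow> real^'d) \<Rightarrow> real^'d \<Rightarrow> real^'d^'d" where
  "strain \<Omega> u x = (1/2) *\<^sub>R (jac \<Omega> u x + transpose (jac \<Omega> u x))"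

definition H1_norm :: "(real^'d) set \<Rightarrow> (real^'d \<Rightarrow> real) \<Rightarrow> real" where
  "H1_norm \<Omega> f = sqrt ((nrm \<Omega> f)\<^sup>2 + (nrm \<Omega> (grad \<Omega> f))\<^sup>2)"

definition H1v_norm :: "(real^'d) set \<Rightarrow> (real^'d \<Rightarrow> real^'d) \<Rightarrow> real" where
  "H1v_norm \<Omega> u = sqrt ((nrm \<Omega> u)\<^sup>2 + (nrm \<Omega> (jac \<Omega> u))\<^sup>2)"

definition Hdiv_norm :: "(real^'d) set \<Rightarrow> (real^'d \<Rightarrow> real^'d) \<Rightarrow> real" where
  "Hdiv_norm \<Omega> w = sqrt ((nrm \<Omega> w)\<^sup>2 + (nrm \<Omega> (dvg \<Omega> w))\<^sup>2)"


section \<open>Traces and the continuous spaces\<close>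

text \<open>The trace operator is the continuous extension of the restriction to the boundary from
  smooth functions to \<open>H1\<close>: \<open>g\<close> is the trace of \<open>f\<close> when some smooth functions converge to \<open>f\<close>
  in \<open>H1\<close> while their boundary values converge to \<open>g\<close> in \<open>L2\<close> of the boundary.\<close>

definition has_trace :: "(real^'d) set \<Rightarrow> (real^'d \<Rightarrow> real) \<Rightarrow> (real^'d \<Rightarrow> real) \<Rightarrow> bool" where
  "has_trace \<Omega> f g \<longleftrightarrow>
     g \<in> borel_measurable surface_measure \<and>
     (\<exists>\<phi> :: nat \<Rightarrow> real^'d \<Rightarrow> real. (\<forall>n. smooth (\<phi> n)) \<and>
        (\<lambda>n. H1_norm \<Omega> (\<lambda>x. \<phi> n x - f x)) \<longlonglongrightarrow> 0 \<and>
        (\<lambda>n. \<integral>\<^sup>+x\<in>frontier \<Omega>. ennreal ((\<phi> n x - g x)\<^sup>2) \<partial>surface_measure) \<longlonglongrightarrow> 0)"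

definition zero_trace_on :: "(real^'d) set \<Rightarrow> (real^'d) set \<Rightarrow> (real^'d \<Rightarrow> real) \<Rightarrow> bool" where
  "zero_trace_on \<Omega> S f \<longleftrightarrow> (\<exists>g. has_trace \<Omega> f g \<and> (AE x in surface_measure. x \<in> S \<longrightarrow> g x = 0))"

text \<open>The normal trace of \<open>w\<close> is the functional on traces of \<open>H1\<close> functions given by Green's
  formula; on \<open>S\<close> it is zero when it annihilates all traces vanishing on the rest of the
  boundary.\<close>

definition normal_trace :: "(real^'d) set \<Rightarrow> (real^'d \<Rightarrow> real^'d) \<Rightarrow> (real^'d \<Rightarrow> real) \<Rightarrow> real" where
  "normal_trace \<Omega> w \<phi> = ip \<Omega> w (grad \<Omega> \<phi>) + ip \<Omega> (dvg \<Omega> w) \<phi>"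

definition zero_normal_trace_on :: "(real^'d) set \<Rightarrow> (real^'d) set \<Rightarrow> (real^'d \<Rightarrow> real^'d) \<Rightarrow> bool" where
  "zero_normal_trace_on \<Omega> S w \<longleftrightarrow>
    (\<forall>\<phi>\<in>H1 \<Omega>. zero_trace_on \<Omega> (frontier \<Omega> - S) \<phi> \<longrightarrow> normal_trace \<Omega> w \<phi> = 0)"

definition V_space :: "(real^'d) set \<Rightarrow> (real^'d) set \<Rightarrow> (real^'d \<Rightarrow> real^'d) set" where
  "V_space \<Omega> \<Gamma>c = {u \<in> H1v \<Omega>. \<forall>i. zero_trace_on \<Omega> (closure \<Gamma>c) (\<lambda>x. u x $ i)}"

definition W_space :: "(real^'d) set \<Rightarrow> (real^'d) set \<Rightarrow> (real^'d \<Rightarrow> real^'d) set" where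
  "W_space \<Omega> \<Gamma>c = {w \<in> Hdiv \<Omega>. zero_normal_trace_on \<Omega> \<Gamma>c w}"

definition Q_space :: "(real^'d) set \<Rightarrow> (real^'d \<Rightarrow> real) set" where
  "Q_space \<Omega> = L2 \<Omega>"


section \<open>Finite-element families and their stability\<close>

text \<open>A linear space of functions that is finite-dimensional modulo null functions.\<close>

definition fe_space :: "(real^'d) set \<Rightarrow> (real^'d \<Rightarrow> 'b::euclidean_space) set \<Rightarrow> bool" where
  "fe_space \<Omega> S \<longleftrightarrow>
     (\<lambda>x. 0) \<in> S \<and> (\<forall>f\<in>S. \<forall>g\<in>S. (\<lambda>x. f x + g x) \<in> S) \<and> (\<forall>f\<in>S. \<forall>c. (\<lambda>x. c *\<^sub>R f x) \<in> S) \<and>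
     (\<exists>B. finite B \<and> B \<subseteq> S \<and>
        (\<forall>f\<in>S. \<exists>c. AE x in lebesgue_on \<Omega>. f x = (\<Sum>b\<in>B. c b *\<^sub>R b x)))"

text \<open>The set \<open>H\<close> consists of the mesh sizes of the family.\<close>

definition fe_family ::
  "(real^'d) set \<Rightarrow> (real^'d) set \<Rightarrow> real set \<Rightarrow> (real \<Rightarrow> (real^'d \<Rightarrow> real^'d) set) \<Rightarrow>
   (real \<Rightarrow> (real^'d \<Rightarrow> real^'d) set) \<Rightarrow> (real \<Rightarrow> (real^'d \<Rightarrow> real) set) \<Rightarrow> bool" where
  "fe_family \<Omega> \<Gamma>c H V W Q \<longleftrightarrow> H \<subseteq> {0<..} \<and>
     (\<forall>h\<in>H. fe_space \<Omega> (V h) \<and> V h \<subseteq> V_space \<Omega> \<Gamma>c \<and>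
            fe_space \<Omega> (W h) \<and> W h \<subseteq> W_space \<Omega> \<Gamma>c \<and>
            fe_space \<Omega> (Q h) \<and> Q h \<subseteq> Q_space \<Omega>)"

definition elast :: "(real^'d) set \<Rightarrow> real \<Rightarrow> real \<Rightarrow> (real^'d \<Rightarrow> real^'d) \<Rightarrow> (real^'d \<Rightarrow> real^'d) \<Rightarrow> real" where
  "elast \<Omega> lam \<mu> u v = 2 * \<mu> * ip \<Omega> (strain \<Omega> u) (strain \<Omega> v) + lam * ip \<Omega> (dvg \<Omega> u) (dvg \<Omega> v)"

text \<open>The suprema are taken in the extended reals.\<close>

definition stokes_stable ::
  "(real^'d) set \<Rightarrow> real set \<Rightarrow> (real \<Rightarrow> (real^'d \<Rightarrow> real^'d) set) \<Rightarrow> (real \<Rightarrow> (real^'d \<Rightarrow> real) set) \<Rightarrow> bool" where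
  "stokes_stable \<Omega> H V Q \<longleftrightarrow>
    (\<exists>\<gamma>>0. \<forall>h\<in>H. \<forall>p\<in>Q h.
       (SUP v\<in>{v\<in>V h. \<not> ae_zero \<Omega> v}. ereal (ip \<Omega> (dvg \<Omega> v) p / H1v_norm \<Omega> v)) \<ge> ereal (\<gamma> * nrm \<Omega> p))"

definition poisson_stable ::
  "(real^'d) set \<Rightarrow> real set \<Rightarrow> (real \<Rightarrow> (real^'d \<Rightarrow> real^'d) set) \<Rightarrow> (real \<Rightarrow> (real^'d \<Rightarrow> real) set) \<Rightarrow> bool" where
  "poisson_stable \<Omega> H W Q \<longleftrightarrow>
    (\<forall>h\<in>H. \<forall>w\<in>W h. \<exists>q\<in>Q h. AE x in lebesgue_on \<Omega>. dvg \<Omega> w x = q x) \<and>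
    (\<exists>C>0. \<forall>h\<in>H. \<forall>w\<in>W h. \<forall>r\<in>W h. \<bar>ip \<Omega> w r\<bar> \<le> C * Hdiv_norm \<Omega> w * Hdiv_norm \<Omega> r) \<and>
    (\<exists>C>0. \<forall>h\<in>H. \<forall>w\<in>W h. \<forall>q\<in>Q h. \<bar>ip \<Omega> (dvg \<Omega> w) q\<bar> \<le> C * Hdiv_norm \<Omega> w * nrm \<Omega> q) \<and>
    (\<exists>c>0. \<forall>h\<in>H. \<forall>w\<in>W h. (\<forall>q\<in>Q h. ip \<Omega> (dvg \<Omega> w) q = 0) \<longrightarrow> ip \<Omega> w w \<ge> c * (Hdiv_norm \<Omega> w)\<^sup>2) \<and>
    (\<exists>\<gamma>>0. \<forall>h\<in>H. \<forall>q\<in>Q h.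
       (SUP w\<in>{w\<in>W h. \<not> ae_zero \<Omega> w}. ereal (ip \<Omega> (dvg \<Omega> w) q / Hdiv_norm \<Omega> w)) \<ge> ereal (\<gamma> * nrm \<Omega> q))"

text \<open>The continuity and coercivity constants of the elasticity form may depend on the Lame
  coefficients, but not on the mesh size.\<close>

definition stokes_biot_stable ::
  "(real^'d) set \<Rightarrow> real set \<Rightarrow> (real \<Rightarrow> (real^'d \<Rightarrow> real^'d) set) \<Rightarrow>
   (real \<Rightarrow> (real^'d \<Rightarrow> real^'d) set) \<Rightarrow> (real \<Rightarrow> (real^'d \<Rightarrow> real) set) \<Rightarrow> bool" where
  "stokes_biot_stable \<Omega> H V W Q \<longleftrightarrow>
    (\<forall>lam\<ge>0. \<forall>\<mu>>0.
      (\<exists>C>0. \<forall>h\<in>H. \<forall>u\<in>V h. \<forall>v\<in>V h. elast \<Omega> lam \<mu> u v \<le> C * H1v_norm \<Omega> u * H1v_norm \<Omega> v) \<and>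
      (\<exists>c>0. \<forall>h\<in>H. \<forall>u\<in>V h. elast \<Omega> lam \<mu> u u \<ge> c * (H1v_norm \<Omega> u)\<^sup>2)) \<and>
    poisson_stable \<Omega> H W Q \<and> stokes_stable \<Omega> H V Q"


section \<open>The discrete Biot system\<close>

text \<open>Permeability tensor fields, in particular constant ones: measurable, symmetric, bounded
  and uniformly positive definite, so that \<open>K\<^sup>-\<^sup>1\<close> maps \<open>L2\<close> to \<open>L2\<close>.\<close>

definition permeability :: "(real^'d) set \<Rightarrow> (real^'d \<Rightarrow> real^'d^'d) \<Rightarrow> bool" where
  "permeability \<Omega> K \<longleftrightarrow> K \<in> borel_measurable (lebesgue_on \<Omega>) \<and>
     (\<forall>x\<in>\<Omega>. transpose (K x) = K x) \<and>
     (\<exists>k0>0. \<exists>k1. \<forall>x\<in>\<Omega>. \<forall>\<xi>. k0 * (\<xi> \<bullet> \<xi>) \<le> \<xi> \<bullet> (K x *v \<xi>) \<and> \<xi> \<bullet> (K x *v \<xi>) \<le> k1 * (\<xi> \<bullet> \<xi>))"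

definition L2_proj :: "(real^'d) set \<Rightarrow> (real^'d \<Rightarrow> real) set \<Rightarrow> (real^'d \<Rightarrow> real) \<Rightarrow> real^'d \<Rightarrow> real" where
  "L2_proj \<Omega> Qh f = (SOME p. p \<in> Qh \<and> (\<forall>q\<in>Qh. ip \<Omega> (\<lambda>x. f x - p x) q = 0))"

definition elast_RQ :: "(real^'d) set \<Rightarrow> (real^'d \<Rightarrow> real) set \<Rightarrow> real \<Rightarrow> real \<Rightarrow>
    (real^'d \<Rightarrow> real^'d) \<Rightarrow> (real^'d \<Rightarrow> real^'d) \<Rightarrow> real" where
  "elast_RQ \<Omega> Qh lam \<mu> u v = 2 * \<mu> * ip \<Omega> (strain \<Omega> u) (strain \<Omega> v)
     + lam * ip \<Omega> (L2_proj \<Omega> Qh (dvg \<Omega> u)) (L2_proj \<Omega> Qh (dvg \<Omega> v))"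

definition darcy :: "(real^'d) set \<Rightarrow> (real^'d \<Rightarrow> real^'d^'d) \<Rightarrow> real \<Rightarrow>
    (real^'d \<Rightarrow> real^'d) \<Rightarrow> (real^'d \<Rightarrow> real^'d) \<Rightarrow> real" where
  "darcy \<Omega> K \<mu>f w r = ip \<Omega> (\<lambda>x. matrix_inv (K x) *v (\<mu>f *\<^sub>R w x)) r"

type_synonym 'd state = "(real^'d \<Rightarrow> real^'d) \<times> (real^'d \<Rightarrow> real^'d) \<times> (real^'d \<Rightarrow> real)"

fun biot_form :: "(real^'d) set \<Rightarrow> (real^'d \<Rightarrow> real) set \<Rightarrow> real \<Rightarrow> real \<Rightarrow> real \<Rightarrow> real \<Rightarrow> real \<Rightarrow>
    (real^'d \<Rightarrow> real^'d^'d) \<Rightarrow> real \<Rightarrow> 'd state \<Rightarrow> 'd state \<Rightarrow> real" where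
  "biot_form \<Omega> Qh lam \<mu> \<alpha> M \<mu>f K \<tau> (u, w, p) (v, r, q) =
     elast_RQ \<Omega> Qh lam \<mu> u v - ip \<Omega> (\<lambda>x. \<alpha> * p x) (dvg \<Omega> v)
     + \<tau> * darcy \<Omega> K \<mu>f w r - \<tau> * ip \<Omega> p (dvg \<Omega> r)
     - \<tau> * ip \<Omega> (dvg \<Omega> w) q - ip \<Omega> (\<lambda>x. (1 / M) * p x) q - ip \<Omega> (\<lambda>x. \<alpha> * dvg \<Omega> u x) q"

definition zeta :: "'d itself \<Rightarrow> real \<Rightarrow> real \<Rightarrow> real" where
  "zeta _ lam \<mu> = sqrt (lam + 2 * \<mu> / real CARD('d))"

definition c_p :: "'d itself \<Rightarrow> real \<Rightarrow> real \<Rightarrow> real \<Rightarrow> real \<Rightarrow> real" where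
  "c_p d lam \<mu> \<alpha> M = inverse (\<alpha>\<^sup>2 / (zeta d lam \<mu>)\<^sup>2 + 1 / M)"

fun norm_D :: "(real^'d) set \<Rightarrow> (real^'d \<Rightarrow> real) set \<Rightarrow> real \<Rightarrow> real \<Rightarrow> real \<Rightarrow> real \<Rightarrow> real \<Rightarrow>
    (real^'d \<Rightarrow> real^'d^'d) \<Rightarrow> real \<Rightarrow> 'd state \<Rightarrow> real" where
  "norm_D \<Omega> Qh lam \<mu> \<alpha> M \<mu>f K \<tau> (u, w, p) =
     sqrt (elast_RQ \<Omega> Qh lam \<mu> u u + inverse (c_p TYPE('d) lam \<mu> \<alpha> M) * (nrm \<Omega> p)\<^sup>2
       + \<tau> * darcy \<Omega> K \<mu>f w w + \<tau>\<^sup>2 * c_p TYPE('d) lam \<mu> \<alpha> M * (nrm \<Omega> (dvg \<Omega> w))\<^sup>2)"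

fun state_zero :: "(real^'d) set \<Rightarrow> 'd state \<Rightarrow> bool" where
  "state_zero \<Omega> (u, w, p) \<longleftrightarrow> ae_zero \<Omega> u \<and> ae_zero \<Omega> w \<and> ae_zero \<Omega> p"

text \<open>The nonzero elements of \<open>V\<^sub>h \<times> W\<^sub>h \<times> Q\<^sub>h\<close>.\<close>

definition nonzero_states :: "(real^'d) set \<Rightarrow> (real^'d \<Rightarrow> real^'d) set \<Rightarrow> (real^'d \<Rightarrow> real^'d) set \<Rightarrow>
    (real^'d \<Rightarrow> real) set \<Rightarrow> 'd state set" where
  "nonzero_states \<Omega> Vh Wh Qh = {x \<in> Vh \<times> Wh \<times> Qh. \<not> state_zero \<Omega> x}"

definition biot_quotient :: "(real^'d) set \<Rightarrow> (real^'d \<Rightarrow> real) set \<Rightarrow> real \<Rightarrow> real \<Rightarrow> real \<Rightarrow> real \<Rightarrow> real \<Rightarrow>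
    (real^'d \<Rightarrow> real^'d^'d) \<Rightarrow> real \<Rightarrow> 'd state \<Rightarrow> 'd state \<Rightarrow> real" where
  "biot_quotient \<Omega> Qh lam \<mu> \<alpha> M \<mu>f K \<tau> x y =
     biot_form \<Omega> Qh lam \<mu> \<alpha> M \<mu>f K \<tau> x y
     / (norm_D \<Omega> Qh lam \<mu> \<alpha> M \<mu>f K \<tau> x * norm_D \<Omega> Qh lam \<mu> \<alpha> M \<mu>f K \<tau> y)"

end

theory Submission
  imports Defs "HOL-Real_Asymp.Real_Asymp"
begin

text \<open>
The energy \<open>a\<^sup>R\<^sup>Q(v, v)\<close> controls \<open>\<zeta>\<^sup>2 \<parallel>P div v\<parallel>\<^sup>2\<close> and is controlled by \<open>\<zeta>\<^sup>2 \<parallel>v\<parallel>\<^sub>1\<^sup>2\<close>, uniformly in the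
Lame coefficients.
Stokes-Biot stability provides continuity and coercivity of the elasticity form with constants
that may depend on \<open>\<lambda>\<close> and \<open>\<mu>\<close>; using it only at \<open>(1, 1)\<close> and \<open>(0, 1)\<close> gives parameter-free constants
\<open>C\<close> and \<open>c\<close> with \<open>2 \<parallel>\<epsilon>(v)\<parallel>\<^sup>2 + \<parallel>div v\<parallel>\<^sup>2 \<le> C \<parallel>v\<parallel>\<^sub>1\<^sup>2\<close> and Korn's inequality \<open>c \<parallel>v\<parallel>\<^sub>1\<^sup>2 \<le> 2 \<parallel>\<epsilon>(v)\<parallel>\<^sup>2\<close>. These yield
\<open>\<zeta>\<^sup>2 \<parallel>P div v\<parallel>\<^sup>2 \<le> \<kappa> a\<^sup>R\<^sup>Q(v, v)\<close> and \<open>a\<^sup>R\<^sup>Q(v, v) \<le> C\<^sub>2 \<zeta>\<^sup>2 \<parallel>v\<parallel>\<^sub>1\<^sup>2\<close> (\<open>Pdiv_le_energy\<close>, \<open>energy_le_H1\<close>).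

Continuity of the Biot form (\<open>biot_form_bounded\<close>) is then Cauchy-Schwarz for each of the seven
terms, as \<open>1 / c\<^sub>p\<close> dominates both \<open>\<alpha>\<^sup>2 / \<zeta>\<^sup>2\<close> and \<open>1 / M\<close>.

For the inf-sup bound (\<open>biot_form_inf_sup\<close>) a given \<open>(u, w, p)\<close> is tested with
\<open>(u - \<theta> \<alpha> / \<zeta>\<^sup>2 v, w, - p - \<eta> \<tau> c\<^sub>p div w)\<close>, where \<open>v\<close> is supplied by the Stokes inf-sup condition for \<open>p\<close>. The
sign change of \<open>p\<close> removes the coupling terms, \<open>v\<close> recovers the part \<open>\<alpha>\<^sup>2 / \<zeta>\<^sup>2 \<parallel>p\<parallel>\<^sup>2\<close> of the pressure norm,
and \<open>div w \<in> Q\<^sub>h\<close> recovers the divergence part. For small \<open>\<theta>\<close> and \<open>\<eta>\<close>, depending on \<open>\<kappa>\<close>, \<open>C\<^sub>2\<close> and the Stokes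
constant only, the mixed terms are absorbed. The permeability enters through the Darcy seminorm
alone, which occurs with its own square on both sides.

These computations presuppose that strain and divergence are linear, although both are choices
of weak derivatives. Weak derivatives are unique almost everywhere by the fundamental lemma of
the calculus of variations, proved here with explicit smooth bump functions that approximate
indicators of boxes. The quotients are meaningful because \<open>norm_D\<close> vanishes exactly on the null
states.\<close>

section \<open>Smooth bump functions on boxes\<close>

text \<open>The functions \<open>t\<^sup>-\<^sup>n exp (-1/t)\<close>, extended by \<open>0\<close> to \<open>t \<le> 0\<close>. Only \<open>n = 0\<close> is wanted for bump
functions; the others occur in its derivatives.\<close>

definition flat :: "nat \<Rightarrow> real \<Rightarrow> real" where
  "flat n t = (if t > 0 then inverse t ^ n * exp (- inverse t) else 0)"

lemma flat_tendsto_0: "(flat n \<longlongrightarrow> 0) (at 0)"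
proof -
  have "((\<lambda>t::real. inverse t ^ n / exp (inverse t)) \<longlongrightarrow> 0) (at_right 0)"
    by (rule filterlim_compose[OF tendsto_power_div_exp_0 filterlim_inverse_at_top_right])
  then have "(flat n \<longlongrightarrow> 0) (at_right 0)"
    by (rule Lim_transform_eventually)
       (auto simp: flat_def eventually_at_filter exp_minus field_simps)
  moreover have "((\<lambda>t. 0) \<longlongrightarrow> (0::real)) (at_left (0::real))" by simp
  then have "(flat n \<longlongrightarrow> 0) (at_left 0)"
    by (rule Lim_transform_eventually) (auto simp: flat_def eventually_at_filter)
  ultimately show ?thesis by (simp add: filterlim_split_at)
qed

text \<open>At \<open>t = 0\<close> the difference quotient of the \<open>n\<close>-th function is the \<open>(n+1)\<close>-st one, which tends to \<open>0\<close>.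
The span of the family is therefore closed under differentiation.\<close>

lemma flat_has_derivative:
  "(flat n has_real_derivative (flat (n + 2) t - real n * flat (n + 1) t)) (at t)"
proof -
  consider "t > 0" | "t < 0" | "t = 0" by linarith
  then show ?thesis
  proof cases
    case 1
    have "((\<lambda>t. inverse t ^ n * exp (- inverse t)) has_real_derivative
        real n * inverse t ^ (n - 1) * (- (inverse t * inverse t)) * exp (- inverse t)
        + inverse t ^ n * (exp (- inverse t) * (inverse t * inverse t))) (at t)"
      using 1 by (auto intro!: derivative_eq_intros)
    also have "real n * inverse t ^ (n - 1) * (- (inverse t * inverse t)) * exp (- inverse t)
        + inverse t ^ n * (exp (- inverse t) * (inverse t * inverse t))
        = flat (n + 2) t - real n * flat (n + 1) t"
      using 1 by (cases n) (simp_all add: flat_def algebra_simps)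
    finally have "((\<lambda>t. inverse t ^ n * exp (- inverse t)) has_real_derivative
        (flat (n + 2) t - real n * flat (n + 1) t)) (at t)" .
    then show ?thesis
      by (rule has_field_derivative_transform_within_open[where S="{0<..}"])
         (use 1 in \<open>auto simp: flat_def\<close>)
  next
    case 2
    have "((\<lambda>t. 0) has_real_derivative (flat (n + 2) t - real n * flat (n + 1) t)) (at t)"
      using 2 by (auto simp: flat_def)
    then show ?thesis
      by (rule has_field_derivative_transform_within_open[where S="{..<0}"])
         (use 2 in \<open>auto simp: flat_def\<close>)
  next
    case 3
    have "((\<lambda>h. flat n h / h) \<longlongrightarrow> 0) (at 0)"
      by (rule Lim_transform_eventually[OF flat_tendsto_0[of "Suc n"]])
         (auto simp: flat_def eventually_at_filter divide_inverse)
    then show ?thesis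
      using 3 by (simp add: DERIV_def flat_def)
  qed
qed

text \<open>An algebra of differentiable functions that contains the partial derivatives of its members
consists of smooth functions. This replaces the calculus of iterated derivatives of products and
compositions: membership in the algebra is all that has to be checked.\<close>

inductive_set flat_algebra :: "(real^'d \<Rightarrow> real) set" where
  const: "(\<lambda>x. c) \<in> flat_algebra"
| flat: "(\<lambda>x. flat n (c * x $ i + b)) \<in> flat_algebra"
| add: "f \<in> flat_algebra \<Longrightarrow> g \<in> flat_algebra \<Longrightarrow> (\<lambda>x. f x + g x) \<in> flat_algebra"
| mult: "f \<in> flat_algebra \<Longrightarrow> g \<in> flat_algebra \<Longrightarrow> (\<lambda>x. f x * g x) \<in> flat_algebra"

lemma nabla_eq:
  assumes "(f has_derivative D) (at x)"
  shows "nabla f x $ i = D (axis i 1)"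
  using frechet_derivative_at[OF assms] by (simp add: nabla_def)

lemma flat_algebra_deriv:
  fixes f :: "real^'d \<Rightarrow> real"
  assumes "f \<in> flat_algebra"
  shows "(\<forall>x. f differentiable (at x)) \<and> (\<forall>i. (\<lambda>x. nabla f x $ i) \<in> flat_algebra)"
  using assms
proof induction
  case (const c)
  have N: "nabla (\<lambda>x. c) x $ i = 0" for x :: "real^'d" and i
    by (rule nabla_eq[where D="\<lambda>h::real^'d. 0" and x = x]) (rule has_derivative_const)
  show ?case by (simp add: N flat_algebra.const)
next
  case (flat n c i b)
  let ?f' = "\<lambda>x :: real^'d. flat (n + 2) (c * x $ i + b) - real n * flat (n + 1) (c * x $ i + b)"
  have D: "((\<lambda>x. flat n (c * x $ i + b)) has_derivative (\<lambda>h. (c * h $ i) * ?f' x)) (at x)" for x :: "real^'d"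
  proof -
    have "((\<lambda>x. c * x $ i + b) has_derivative (\<lambda>h. c * h $ i)) (at x)"
      by (auto intro!: derivative_eq_intros bounded_linear_imp_has_derivative bounded_linear_vec_nth)
    from DERIV_compose_FDERIV[OF flat_has_derivative this] show ?thesis .
  qed
  have N: "nabla (\<lambda>x. flat n (c * x $ i + b)) x $ j = (c * axis j 1 $ i) * ?f' x" for x :: "real^'d" and j
    by (rule nabla_eq[OF D])
  have "(\<lambda>x. (c * axis j 1 $ i) * (flat (n + 2) (c * x $ i + b) + (- real n) * flat (n + 1) (c * x $ i + b)))
     \<in> flat_algebra" for j
    by (intro flat_algebra.intros)
  then show ?case using D by (auto simp: N differentiable_def)
next
  case (add f g)
  have D: "(f has_derivative frechet_derivative f (at x)) (at x)"
          "(g has_derivative frechet_derivative g (at x)) (at x)" for x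
    using add by (auto simp: frechet_derivative_works)
  have "nabla (\<lambda>x. f x + g x) x $ i = nabla f x $ i + nabla g x $ i" for x i
    using nabla_eq[OF has_derivative_add[OF D]] by (simp add: nabla_def)
  then show ?case using add by (auto intro: flat_algebra.add)
next
  case (mult f g)
  have D: "(f has_derivative frechet_derivative f (at x)) (at x)"
          "(g has_derivative frechet_derivative g (at x)) (at x)" for x
    using mult by (auto simp: frechet_derivative_works)
  have "nabla (\<lambda>x. f x * g x) x $ i = f x * nabla g x $ i + nabla f x $ i * g x" for x i
    using nabla_eq[OF has_derivative_mult[OF D]] by (simp add: nabla_def)
  then show ?case using mult by (auto intro!: flat_algebra.add flat_algebra.mult)
qed

lemma flat_algebra_smooth:
  assumes "f \<in> flat_algebra"
  shows "smooth f"
proof -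
  have "Ck k f" if "f \<in> flat_algebra" for k and f :: "real^'d \<Rightarrow> real"
    using that
  proof (induction k arbitrary: f)
    case 0
    then show ?case
      using flat_algebra_deriv[OF 0]
      by (auto intro!: differentiable_imp_continuous_on simp: differentiable_on_def
          intro: differentiable_at_withinI)
  next
    case (Suc k)
    then show ?case using flat_algebra_deriv[OF Suc.prems] by auto
  qed
  then show ?thesis using assms by (auto simp: smooth_def)
qed

text \<open>As \<open>n\<close> grows the factors tend to \<open>1\<close> inside the box, and without the shift by \<open>-1\<close> the product
would be positive up to the boundary. The shift moves the support a distance \<open>1/n\<close> into the open
box, so that the box need not have its closure in the domain.\<close>

definition box_bump :: "real^'d \<Rightarrow> real^'d \<Rightarrow> nat \<Rightarrow> real^'d \<Rightarrow> real" where
  "box_bump a b n x =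
     (\<Prod>i\<in>UNIV. flat 0 (real n * (x $ i - a $ i) - 1) * flat 0 (real n * (b $ i - x $ i) - 1))"

lemma box_bump_smooth: "smooth (box_bump a b n)"
proof (rule flat_algebra_smooth)
  have "(\<lambda>x. \<Prod>i\<in>I. flat 0 (real n * (x $ i - a $ i) - 1) * flat 0 (real n * (b $ i - x $ i) - 1))
     \<in> flat_algebra" if "finite I" for I
    using that
  proof induction
    case empty
    then show ?case by (simp add: flat_algebra.const)
  next
    case (insert i I)
    have "(\<lambda>x. flat 0 (real n * x $ i + (- real n * a $ i - 1)) * flat 0 ((- real n) * x $ i + (real n * b $ i - 1)))
      \<in> flat_algebra"
      by (intro flat_algebra.intros)
    then have "(\<lambda>x. flat 0 (real n * (x $ i - a $ i) - 1) * flat 0 (real n * (b $ i - x $ i) - 1))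
      \<in> flat_algebra"
      by (simp add: algebra_simps)
    with insert show ?case by (simp add: flat_algebra.mult)
  qed
  then show "box_bump a b n \<in> flat_algebra"
    by (simp add: box_bump_def[abs_def])
qed

lemma box_bump_nonzeroD:
  assumes "box_bump a b n x \<noteq> 0" "n > 0"
  shows "x $ i \<ge> a $ i + 1 / real n \<and> x $ i \<le> b $ i - 1 / real n"
proof -
  have "flat 0 (real n * (x $ i - a $ i) - 1) \<noteq> 0 \<and> flat 0 (real n * (b $ i - x $ i) - 1) \<noteq> 0"
    using assms by (auto simp: box_bump_def)
  then have "real n * (x $ i - a $ i) - 1 > 0" "real n * (b $ i - x $ i) - 1 > 0"
    by (auto simp: flat_def split: if_splits)
  then show ?thesis using assms(2) by (auto simp: field_simps)
qed

lemma box_bump_test_fun: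
  assumes "box a b \<subseteq> \<Omega>" "n > 0"
  shows "test_fun \<Omega> (box_bump a b n)"
proof -
  let ?C = "cbox (\<chi> i. a $ i + 1 / real n) (\<chi> i. b $ i - 1 / real n)"
  have sub: "closure {x. box_bump a b n x \<noteq> 0} \<subseteq> ?C"
    by (rule closure_minimal) (use box_bump_nonzeroD[of a b n, OF _ assms(2)] in \<open>auto simp: mem_box_cart\<close>)
  have "?C \<subseteq> box a b"
  proof
    fix x assume "x \<in> ?C"
    then have "a $ i + 1 / real n \<le> x $ i \<and> x $ i \<le> b $ i - 1 / real n" for i
      by (auto simp: mem_box_cart)
    moreover have "1 / real n > 0" using assms by auto
    ultimately have "a $ i < x $ i \<and> x $ i < b $ i" for i by (smt (verit))
    then show "x \<in> box a b" by (auto simp: mem_box_cart)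
  qed
  with sub assms have "closure {x. box_bump a b n x \<noteq> 0} \<subseteq> \<Omega>" by blast
  moreover have "compact (closure {x. box_bump a b n x \<noteq> 0})"
    using sub by (meson bounded_cbox bounded_subset closed_closure compact_eq_bounded_closed)
  ultimately show ?thesis by (simp add: test_fun_def box_bump_smooth)
qed

lemma flat_0_bounds: "0 \<le> flat 0 t" "flat 0 t \<le> 1"
  by (auto simp: flat_def)

lemma box_bump_abs_le_1: "\<bar>box_bump a b n x\<bar> \<le> 1"
  unfolding box_bump_def abs_prod abs_mult
  by (rule prod_le_1) (auto simp: flat_0_bounds intro!: mult_le_one)

lemma flat_0_tendsto_1:
  assumes "r > 0"
  shows "(\<lambda>n. flat 0 (real n * r - 1)) \<longlonglongrightarrow> 1"
proof -
  have top: "filterlim (\<lambda>n. real n * r - 1) at_top sequentially"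
    using assms by real_asymp
  have *: "(\<lambda>n. exp (- inverse (real n * r - 1))) \<longlonglongrightarrow> exp (- 0)"
    by (intro tendsto_intros tendsto_inverse_0_at_top top)
  have **: "\<forall>\<^sub>F n in sequentially. real n * r - 1 > 0"
    using top unfolding filterlim_at_top_dense by blast
  show ?thesis
    by (rule Lim_transform_eventually[of "\<lambda>n. exp (- inverse (real n * r - 1))"])
       (use * ** in \<open>auto simp: flat_def elim!: eventually_mono\<close>)
qed

lemma box_bump_tendsto_indicator:
  "(\<lambda>n. box_bump a b (Suc n) x) \<longlonglongrightarrow> indicator (box a b) x"
proof (cases "x \<in> box a b")
  case True
  have "(\<lambda>n. box_bump a b n x) \<longlonglongrightarrow> (\<Prod>i\<in>(UNIV::'a set). 1 * 1)"
    unfolding box_bump_def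
    by (intro tendsto_prod tendsto_mult flat_0_tendsto_1) (use True in \<open>auto simp: mem_box_cart\<close>)
  then show ?thesis using True by (auto intro: LIMSEQ_Suc)
next
  case False
  have "box_bump a b (Suc n) x = 0" for n
  proof (rule ccontr)
    assume "box_bump a b (Suc n) x \<noteq> 0"
    moreover have "1 / real (Suc n) > 0" by simp
    ultimately have "a $ i < x $ i \<and> x $ i < b $ i" for i
      using box_bump_nonzeroD[of a b "Suc n" x i] by (smt (verit) zero_less_Suc)
    with False show False by (auto simp: mem_box_cart)
  qed
  then show ?thesis using False by simp
qed

text \<open>Open boxes are an intersection-stable generator of the Borel sets, so the integral vanishes over
every Borel set, and over every Lebesgue set because that differs from a Borel set by a null set.
The support hypothesis makes the integral over the whole space one over a box, as needed for
complements.\<close>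

lemma AE_zero_if_box_integrals_zero:
  fixes g :: "'a::euclidean_space \<Rightarrow> real"
  assumes g: "integrable lebesgue g"
    and box: "\<And>a b. (\<integral>x. indicator (box a b) x * g x \<partial>lebesgue) = 0"
    and supp: "\<And>x. x \<notin> box c d \<Longrightarrow> g x = 0"
  shows "AE x in lebesgue. g x = 0"
proof -
  have ind: "integrable lebesgue (\<lambda>x. indicator A x * g x)" if "A \<in> sets lebesgue" for A
    using integrable_mult_indicator[OF that g] by simp
  have borel: "(\<integral>x. indicator A x * g x \<partial>lebesgue) = 0" if "A \<in> sets borel" for A
  proof -
    have "Int_stable (range (\<lambda>(a, b). box a b :: 'a set))"
      unfolding Int_stable_def by (auto simp: box_Int_box)
    moreover have "range (\<lambda>(a, b). box a b :: 'a set) \<subseteq> Pow UNIV" by simp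
    moreover have "A \<in> sigma_sets UNIV (range (\<lambda>(a, b). box a b :: 'a set))"
      using that by (simp add: borel_eq_box sets_measure_of)
    ultimately show ?thesis
    proof (induction rule: sigma_sets_induct_disjoint)
      case (basic A)
      then show ?case using box by auto
    next
      case empty
      then show ?case by simp
    next
      case (compl A)
      then have A: "A \<in> sets lebesgue"
        by (metis borel_eq_box sets_completionI_sets sets_lborel sets_measure_of subset_UNIV Pow_UNIV)
      have tot: "(\<integral>x. g x \<partial>lebesgue) = 0"
      proof -
        have "(\<integral>x. g x \<partial>lebesgue) = (\<integral>x. indicator (box c d) x * g x \<partial>lebesgue)"
          by (rule Bochner_Integration.integral_cong) (auto simp: indicator_def supp)
        then show ?thesis using box by simp
      qed
      have "(\<integral>x. indicator (UNIV - A) x * g x \<partial>lebesgue) = (\<integral>x. g x - indicator A x * g x \<partial>lebesgue)"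
        by (rule Bochner_Integration.integral_cong) (auto simp: indicator_def)
      also have "\<dots> = 0" using compl g ind[OF A] tot by simp
      finally show ?case by simp
    next
      case (union A)
      then have A: "range A \<subseteq> sets lebesgue"
        by (smt (verit) borel_eq_box sets_completionI_sets sets_lborel sets_measure_of subset_UNIV Pow_UNIV subset_eq)
      have "(LINT x:(\<Union>i. A i)|lebesgue. g x) = (\<Sum>i. (LINT x:(A i)|lebesgue. g x))"
      proof (rule lebesgue_integral_countable_add)
        show "A i \<inter> A j = {}" if "i \<noteq> j" for i j
          using union that by (auto simp: disjoint_family_on_def)
        show "set_integrable lebesgue (\<Union>i. A i) g"
          unfolding set_integrable_def using A by (intro integrable_mult_indicator g) auto
      qed (use A in auto)
      with union show ?case by (simp add: set_lebesgue_integral_def)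
    qed
  qed
  have leb: "(\<integral>x. indicator A x * g x \<partial>lebesgue) = 0" if A: "A \<in> sets lebesgue" for A
  proof -
    obtain B N N' where *: "A = B \<union> N" "N \<subseteq> N'" "N' \<in> null_sets lborel" "B \<in> sets lborel"
      using sets_completionE[OF A] by metis
    have "AE x in lebesgue. x \<notin> N'"
      using * by (intro AE_not_in) (auto intro: null_sets_completionI)
    then have "AE x in lebesgue. indicator A x * g x = indicator B x * g x"
      by eventually_elim (use * in \<open>auto simp: indicator_def\<close>)
    then have "(\<integral>x. indicator A x * g x \<partial>lebesgue) = (\<integral>x. indicator B x * g x \<partial>lebesgue)"
      using * ind[OF A] ind[of B] by (intro integral_cong_AE) (auto intro: borel_measurable_integrable)
    with borel[of B] * show ?thesis by simp
  qed
  show ?thesis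
    using density_unique_real[OF g, of "\<lambda>_. 0"] leb
    by (auto simp: set_lebesgue_integral_def)
qed

section \<open>The fundamental lemma of the calculus of variations\<close>

lemma smooth_continuous: "smooth f \<Longrightarrow> continuous_on UNIV f"
  by (auto simp: smooth_def dest: spec[of _ 0])

lemma smooth_nabla_continuous:
  assumes "smooth f"
  shows "continuous_on UNIV (nabla f)"
proof -
  have "Ck (Suc 0) f" using assms by (simp add: smooth_def del: Ck.simps)
  then have "\<forall>i. continuous_on UNIV (\<lambda>x. nabla f x $ i)" by simp
  then have "continuous_on UNIV (\<lambda>x. \<chi> i. nabla f x $ i)"
    by (intro continuous_on_vec_lambda) auto
  then show ?thesis by simp
qed

lemma continuous_measurable_lebesgue_on:
  fixes f :: "'a::euclidean_space \<Rightarrow> 'b::euclidean_space"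
  assumes "continuous_on UNIV f"
  shows "f \<in> borel_measurable (lebesgue_on \<Omega>)"
  using assms
  by (intro measurable_restrict_space1 measurable_completion) (simp add: borel_measurable_continuous_onI)

text \<open>Dominated convergence: the bump functions are bounded by \<open>1\<close> and tend to the indicator of the box.\<close>

lemma box_integral_zero:
  fixes g :: "real^'d \<Rightarrow> real"
  assumes g: "integrable (lebesgue_on \<Omega>) g"
    and orth: "\<And>\<phi>. test_fun \<Omega> \<phi> \<Longrightarrow> ip \<Omega> g \<phi> = 0"
    and sub: "box a b \<subseteq> \<Omega>"
  shows "(\<integral>x. g x * indicator (box a b) x \<partial>lebesgue_on \<Omega>) = 0"
proof -
  have meas: "(\<lambda>x. g x * box_bump a b (Suc n) x) \<in> borel_measurable (lebesgue_on \<Omega>)" for n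
    by (intro borel_measurable_times borel_measurable_integrable[OF g]
        continuous_measurable_lebesgue_on smooth_continuous box_bump_smooth)
  have lim: "(\<lambda>n. g x * box_bump a b (Suc n) x) \<longlonglongrightarrow> g x * indicator (box a b) x" for x
    by (intro tendsto_mult tendsto_const box_bump_tendsto_indicator)
  have "(\<lambda>n. \<integral>x. g x * box_bump a b (Suc n) x \<partial>lebesgue_on \<Omega>)
      \<longlonglongrightarrow> (\<integral>x. g x * indicator (box a b) x \<partial>lebesgue_on \<Omega>)"
  proof (rule integral_dominated_convergence)
    show "integrable (lebesgue_on \<Omega>) (\<lambda>x. \<bar>g x\<bar>)" using g by simp
    show "AE x in lebesgue_on \<Omega>. norm (g x * box_bump a b (Suc n) x) \<le> \<bar>g x\<bar>" for n
      using box_bump_abs_le_1[of a b "Suc n"] by (intro AE_I2) (simp add: abs_mult mult_left_le)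
    show "(\<lambda>x. g x * indicator (box a b) x) \<in> borel_measurable (lebesgue_on \<Omega>)"
      by (rule borel_measurable_LIMSEQ_real[OF lim meas])
  qed (use meas lim in auto)
  moreover have "(\<integral>x. g x * box_bump a b (Suc n) x \<partial>lebesgue_on \<Omega>) = 0" for n
    using orth[OF box_bump_test_fun[OF sub, of "Suc n"]] by (simp add: ip_def)
  ultimately show ?thesis by (simp add: LIMSEQ_const_iff)
qed

text \<open>Inside a fixed box contained in \<open>\<Omega>\<close> all integrals over subboxes vanish, hence so does \<open>g\<close> almost
everywhere there; countably many such boxes cover \<open>\<Omega>\<close>.\<close>

lemma fundamental_lemma_calculus_of_variations:
  fixes g :: "real^'d \<Rightarrow> real"
  assumes op: "open \<Omega>"
    and g: "integrable (lebesgue_on \<Omega>) g"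
    and orth: "\<And>\<phi>. test_fun \<Omega> \<phi> \<Longrightarrow> ip \<Omega> g \<phi> = 0"
  shows "AE x in lebesgue_on \<Omega>. g x = 0"
proof -
  have \<Omega>: "\<Omega> \<in> sets lebesgue" using op by (simp add: lebesgue_openin)
  have loc: "AE x in lebesgue. x \<in> box c d \<longrightarrow> g x = 0" if cd: "box c d \<subseteq> \<Omega>" for c d
  proof -
    have "AE x in lebesgue. indicator (box c d) x * g x = 0"
    proof (rule AE_zero_if_box_integrals_zero[where c=c and d=d])
      have "integrable lebesgue (\<lambda>x. indicator \<Omega> x *\<^sub>R g x)"
        using g \<Omega> by (subst integrable_restrict_space[symmetric]) simp_all
      then have "integrable lebesgue (\<lambda>x. indicator (box c d) x *\<^sub>R (indicator \<Omega> x *\<^sub>R g x))"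
        by (rule integrable_mult_indicator[rotated]) simp
      also have "(\<lambda>x. indicator (box c d) x *\<^sub>R (indicator \<Omega> x *\<^sub>R g x)) = (\<lambda>x. indicator (box c d) x * g x)"
        using cd by (auto simp: indicator_def fun_eq_iff)
      finally show "integrable lebesgue (\<lambda>x. indicator (box c d) x * g x)" .
    next
      fix a b :: "real^'d"
      obtain a' b' where ab: "box a b \<inter> box c d = box a' b'"
        using box_Int_box[of a b c d] by blast
      then have sub: "box a' b' \<subseteq> \<Omega>" using cd by blast
      have "(\<integral>x. indicator (box a b) x * (indicator (box c d) x * g x) \<partial>lebesgue)
          = (\<integral>x. indicator \<Omega> x *\<^sub>R (g x * indicator (box a' b') x) \<partial>lebesgue)"
        using sub by (intro Bochner_Integration.integral_cong) (auto simp: ab[symmetric] indicator_def)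
      also have "\<dots> = (\<integral>x. g x * indicator (box a' b') x \<partial>lebesgue_on \<Omega>)"
        using \<Omega> by (simp add: integral_restrict_space)
      also have "\<dots> = 0" by (rule box_integral_zero[OF g orth sub])
      finally show "(\<integral>x. indicator (box a b) x * (indicator (box c d) x * g x) \<partial>lebesgue) = 0" .
    qed auto
    then show ?thesis by eventually_elim (auto simp: indicator_def split: if_splits)
  qed
  obtain D where D: "countable D" "D \<subseteq> Pow \<Omega>" "\<And>X. X \<in> D \<Longrightarrow> \<exists>a b. X = box a b" "\<Union>D = \<Omega>"
    using open_countable_Union_open_box[OF op] by metis
  have "AE x in lebesgue. \<forall>X\<in>D. x \<in> X \<longrightarrow> g x = 0"
    using D(1) loc D(2,3) by (subst AE_ball_countable) (auto, metis PowD subsetD)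
  then have "AE x in lebesgue. x \<in> \<Omega> \<longrightarrow> g x = 0"
    by eventually_elim (use D(4) in blast)
  then show ?thesis using \<Omega> by (simp add: AE_restrict_space_iff)
qed

section \<open>Square-integrable functions\<close>

lemma L2_measurable: "f \<in> L2 \<Omega> \<Longrightarrow> f \<in> borel_measurable (lebesgue_on \<Omega>)"
  by (simp add: L2_def)

lemma L2_inner_integrable:
  assumes "f \<in> L2 \<Omega>" "g \<in> L2 \<Omega>"
  shows "integrable (lebesgue_on \<Omega>) (\<lambda>x. f x \<bullet> g x)"
proof (rule Bochner_Integration.integrable_bound)
  show "integrable (lebesgue_on \<Omega>) (\<lambda>x. (norm (f x))\<^sup>2 + (norm (g x))\<^sup>2)"
    using assms by (simp add: L2_def)
  show "AE x in lebesgue_on \<Omega>. norm (f x \<bullet> g x) \<le> norm ((norm (f x))\<^sup>2 + (norm (g x))\<^sup>2)"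
  proof (rule AE_I2)
    fix x
    have "norm (f x \<bullet> g x) \<le> norm (f x) * norm (g x)" by (simp add: Cauchy_Schwarz_ineq2)
    also have "\<dots> \<le> (norm (f x))\<^sup>2 + (norm (g x))\<^sup>2"
      using sum_squares_bound[of "norm (f x)" "norm (g x)"]
        mult_nonneg_nonneg[OF norm_ge_zero[of "f x"] norm_ge_zero[of "g x"]] by linarith
    finally show "norm (f x \<bullet> g x) \<le> norm ((norm (f x))\<^sup>2 + (norm (g x))\<^sup>2)" by simp
  qed
  show "(\<lambda>x. f x \<bullet> g x) \<in> borel_measurable (lebesgue_on \<Omega>)"
    using assms by (intro borel_measurable_inner L2_measurable)
qed

lemma ip_commute: "ip \<Omega> f g = ip \<Omega> g f"
  by (simp add: ip_def inner_commute)

lemma ip_nonneg: "ip \<Omega> f f \<ge> 0"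
  by (simp add: ip_def)

lemma nrm_squared: "(nrm \<Omega> f)\<^sup>2 = ip \<Omega> f f"
  by (simp add: nrm_def ip_nonneg)

lemma ip_comb:
  assumes "f \<in> L2 \<Omega>" "g \<in> L2 \<Omega>" "h \<in> L2 \<Omega>"
  shows "ip \<Omega> (\<lambda>x. f x + c *\<^sub>R g x) h = ip \<Omega> f h + c * ip \<Omega> g h"
  using L2_inner_integrable[OF assms(1,3)] L2_inner_integrable[OF assms(2,3)]
  by (simp add: ip_def inner_add_left)

lemma ip_cong:
  assumes "AE x in lebesgue_on \<Omega>. f x = f' x" "f \<in> L2 \<Omega>" "f' \<in> L2 \<Omega>" "g \<in> L2 \<Omega>"
  shows "ip \<Omega> f g = ip \<Omega> f' g"
  unfolding ip_def using assms
  by (intro integral_cong_AE borel_measurable_inner L2_measurable) auto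

text \<open>All linear structure is expressed through the single operation \<open>f + c g\<close>, which gives sums and
multiples at once.\<close>

lemma L2_comb:
  assumes "f \<in> L2 \<Omega>" "g \<in> L2 \<Omega>"
  shows "(\<lambda>x. f x + c *\<^sub>R g x) \<in> L2 \<Omega>"
proof -
  have "integrable (lebesgue_on \<Omega>) (\<lambda>x. f x \<bullet> f x + 2 * c * (f x \<bullet> g x) + c\<^sup>2 * (g x \<bullet> g x))"
    using L2_inner_integrable[OF assms(1) assms(1)] L2_inner_integrable[OF assms(1) assms(2)]
      L2_inner_integrable[OF assms(2) assms(2)] by simp
  also have "(\<lambda>x. f x \<bullet> f x + 2 * c * (f x \<bullet> g x) + c\<^sup>2 * (g x \<bullet> g x)) = (\<lambda>x. (norm (f x + c *\<^sub>R g x))\<^sup>2)"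
  proof
    fix x
    show "f x \<bullet> f x + 2 * c * (f x \<bullet> g x) + c\<^sup>2 * (g x \<bullet> g x) = (norm (f x + c *\<^sub>R g x))\<^sup>2"
      using inner_commute[of "g x" "f x"]
      unfolding power2_norm_eq_inner by (simp add: inner_add_left inner_add_right power2_eq_square algebra_simps)
  qed
  finally have "integrable (lebesgue_on \<Omega>) (\<lambda>x. (norm (f x + c *\<^sub>R g x))\<^sup>2)" .
  moreover have "(\<lambda>x. f x + c *\<^sub>R g x) \<in> borel_measurable (lebesgue_on \<Omega>)"
    by (rule borel_measurable_add[OF L2_measurable[OF assms(1)]
          borel_measurable_scaleR[OF borel_measurable_const L2_measurable[OF assms(2)]]])
  ultimately show ?thesis unfolding L2_def by blast
qed

lemma L2_zero: "(\<lambda>x. 0) \<in> L2 \<Omega>"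
  by (simp add: L2_def)

lemma L2_scale:
  assumes "f \<in> L2 \<Omega>" shows "(\<lambda>x. c *\<^sub>R f x) \<in> L2 \<Omega>"
  using L2_comb[OF L2_zero assms] by simp

lemma L2_sum:
  assumes "\<And>i. i \<in> I \<Longrightarrow> f i \<in> L2 \<Omega>"
  shows "(\<lambda>x. \<Sum>i\<in>I. f i x) \<in> L2 \<Omega>"
  using assms
proof (induction I rule: infinite_finite_induct)
  case (insert i I)
  then show ?case using L2_comb[of "f i" \<Omega> "\<lambda>x. \<Sum>i\<in>I. f i x" 1] by simp
qed (auto simp: L2_zero)

lemma L2_bounded_linear:
  assumes "bounded_linear A" "f \<in> L2 \<Omega>"
  shows "(\<lambda>x. A (f x)) \<in> L2 \<Omega>"
proof -
  obtain B where B: "\<And>x. norm (A x) \<le> norm x * B"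
    using bounded_linear.bounded[OF assms(1)] by blast
  have m: "(\<lambda>x. A (f x)) \<in> borel_measurable (lebesgue_on \<Omega>)"
    by (rule borel_measurable_continuous_on[OF linear_continuous_on[OF assms(1)] L2_measurable[OF assms(2)]])
  have "integrable (lebesgue_on \<Omega>) (\<lambda>x. (norm (A (f x)))\<^sup>2)"
  proof (rule Bochner_Integration.integrable_bound)
    show "integrable (lebesgue_on \<Omega>) (\<lambda>x. B\<^sup>2 * (norm (f x))\<^sup>2)"
      using assms by (simp add: L2_def)
    show "AE x in lebesgue_on \<Omega>. norm ((norm (A (f x)))\<^sup>2) \<le> norm (B\<^sup>2 * (norm (f x))\<^sup>2)"
      using power_mono[OF B norm_ge_zero, of _ 2]
      by (intro AE_I2) (simp add: power_mult_distrib mult.commute)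
  qed (use m in auto)
  with m show ?thesis by (simp add: L2_def)
qed

lemma L2_component: "f \<in> L2 \<Omega> \<Longrightarrow> (\<lambda>x. f x $ i) \<in> L2 \<Omega>"
  by (rule L2_bounded_linear[OF bounded_linear_vec_nth])

lemma L2_vec:
  fixes f :: "real^'d \<Rightarrow> 'b::euclidean_space^'n"
  assumes "\<And>i. (\<lambda>x. f x $ i) \<in> L2 \<Omega>"
  shows "f \<in> L2 \<Omega>"
proof -
  have "linear (axis i :: 'b \<Rightarrow> 'b^'n)" for i
    by (auto simp: linear_iff vec_eq_iff axis_def)
  then have "(\<lambda>x. \<Sum>i\<in>UNIV. axis i (f x $ i)) \<in> L2 \<Omega>"
    by (intro L2_sum L2_bounded_linear[OF _ assms] linear_conv_bounded_linear[THEN iffD1])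
  also have "(\<lambda>x. \<Sum>i\<in>UNIV. axis i (f x $ i)) = f"
    by (auto simp: fun_eq_iff vec_eq_iff axis_def if_distrib cong: if_cong)
  finally show ?thesis .
qed

lemma ip_components:
  assumes "f \<in> L2 \<Omega>" "g \<in> L2 \<Omega>"
  shows "ip \<Omega> f g = (\<Sum>i\<in>UNIV. ip \<Omega> (\<lambda>x. f x $ i) (\<lambda>x. g x $ i))"
  unfolding ip_def inner_vec_def using assms
  by (intro Bochner_Integration.integral_sum L2_inner_integrable L2_component)

lemma ae_zero_iff:
  assumes "f \<in> L2 \<Omega>"
  shows "ae_zero \<Omega> f \<longleftrightarrow> ip \<Omega> f f = 0"
  using integral_nonneg_eq_0_iff_AE[OF L2_inner_integrable[OF assms assms]]
  by (simp add: ae_zero_def ip_def)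

section \<open>Uniqueness and linearity of weak derivatives\<close>

text \<open>On a bounded set all functions continuous on the whole space are square integrable, in particular
constants and test functions with their gradients. All pairings in the definitions of weak derivatives are then
integrals of integrable functions, and square-integrable functions are integrable.\<close>

locale bounded_open =
  fixes \<Omega> :: "(real^'d) set"
  assumes op: "open \<Omega>" and bd: "bounded \<Omega>"
begin

lemma finite_measure_domain: "finite_measure (lebesgue_on \<Omega>)"
  using op bd by (intro finite_measure_lebesgue_on lmeasurable_open)

lemma continuous_L2:
  fixes f :: "real^'d \<Rightarrow> 'b::euclidean_space"
  assumes "continuous_on UNIV f"
  shows "f \<in> L2 \<Omega>"
proof -
  interpret finite_measure "lebesgue_on \<Omega>" by (rule finite_measure_domain)
  have "compact (f ` closure \<Omega>)"
    using bd assms by (intro compact_continuous_image) (auto intro: continuous_on_subset simp: compact_closure)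
  then obtain B where B: "\<And>x. x \<in> closure \<Omega> \<Longrightarrow> norm (f x) \<le> B"
    using compact_imp_bounded[of "f ` closure \<Omega>"] by (auto simp: bounded_iff)
  have m: "f \<in> borel_measurable (lebesgue_on \<Omega>)"
    using assms by (rule continuous_measurable_lebesgue_on)
  have "integrable (lebesgue_on \<Omega>) (\<lambda>x. (norm (f x))\<^sup>2)"
    using B m closure_subset[of \<Omega>]
    by (intro integrable_const_bound[where B="B\<^sup>2"] AE_I2) (auto intro!: power_mono)
  with m show ?thesis by (simp add: L2_def)
qed

lemma L2_integrable:
  fixes f :: "real^'d \<Rightarrow> real"
  assumes "f \<in> L2 \<Omega>"
  shows "integrable (lebesgue_on \<Omega>) f"
  using L2_inner_integrable[OF assms continuous_L2[of "\<lambda>_. 1"]] by simp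

lemma test_fun_L2:
  assumes "test_fun \<Omega> \<phi>"
  shows "\<phi> \<in> L2 \<Omega>" "nabla \<phi> \<in> L2 \<Omega>"
  using assms by (auto simp: test_fun_def intro!: continuous_L2 smooth_continuous smooth_nabla_continuous)

lemma weak_div_unique:
  assumes "weak_div \<Omega> w g" "weak_div \<Omega> w h" "g \<in> L2 \<Omega>" "h \<in> L2 \<Omega>"
  shows "AE x in lebesgue_on \<Omega>. g x = h x"
proof -
  have L: "(\<lambda>x. g x + (-1) *\<^sub>R h x) \<in> L2 \<Omega>" using assms by (intro L2_comb)
  have "AE x in lebesgue_on \<Omega>. g x + (-1) *\<^sub>R h x = 0"
  proof (rule fundamental_lemma_calculus_of_variations[OF op L2_integrable[OF L]])
    fix \<phi> assume "test_fun \<Omega> \<phi>"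
    then show "ip \<Omega> (\<lambda>x. g x + (-1) *\<^sub>R h x) \<phi> = 0"
      using assms by (subst ip_comb) (auto simp: weak_div_def test_fun_L2)
  qed
  then show ?thesis by eventually_elim simp
qed

lemma weak_div_comb:
  assumes "weak_div \<Omega> v g" "weak_div \<Omega> w h" "v \<in> L2 \<Omega>" "w \<in> L2 \<Omega>" "g \<in> L2 \<Omega>" "h \<in> L2 \<Omega>"
  shows "weak_div \<Omega> (\<lambda>x. v x + c *\<^sub>R w x) (\<lambda>x. g x + c *\<^sub>R h x)"
  using assms unfolding weak_div_def
  by (auto simp: ip_comb test_fun_L2 simp del: real_scaleR_def)

lemma dvg_props:
  assumes "w \<in> Hdiv \<Omega>"
  shows "dvg \<Omega> w \<in> L2 \<Omega>" "weak_div \<Omega> w (dvg \<Omega> w)"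
  using someI_ex[of "\<lambda>g. g \<in> L2 \<Omega> \<and> weak_div \<Omega> w g"] assms
  by (auto simp: Hdiv_def dvg_def)

text \<open>The chosen weak divergence agrees almost everywhere with any other. Linearity of the
divergence, and later of the gradient, strain and the Biot form, rests on this.\<close>

lemma dvg_eqI:
  assumes "w \<in> L2 \<Omega>" "weak_div \<Omega> w g" "g \<in> L2 \<Omega>"
  shows "AE x in lebesgue_on \<Omega>. dvg \<Omega> w x = g x"
  using assms weak_div_unique[OF dvg_props(2) assms(2) dvg_props(1)] by (auto simp: Hdiv_def)

lemma dvg_comb:
  assumes "v \<in> Hdiv \<Omega>" "w \<in> Hdiv \<Omega>"
  shows "AE x in lebesgue_on \<Omega>. dvg \<Omega> (\<lambda>x. v x + c *\<^sub>R w x) x = dvg \<Omega> v x + c *\<^sub>R dvg \<Omega> w x"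
  using assms by (intro dvg_eqI weak_div_comb L2_comb dvg_props) (auto simp: Hdiv_def)

lemma dvg_ae_zero:
  assumes "w \<in> L2 \<Omega>" "ae_zero \<Omega> w"
  shows "ae_zero \<Omega> (dvg \<Omega> w)"
proof -
  have "weak_div \<Omega> w (\<lambda>x. 0)"
    unfolding weak_div_def
    using assms ip_cong[where f=w and f'="\<lambda>x. 0"] by (auto simp: ae_zero_def L2_zero test_fun_L2 ip_def)
  with dvg_eqI[OF assms(1) this L2_zero] show ?thesis by (simp add: ae_zero_def)
qed

lemma weak_grad_unique:
  assumes "weak_grad \<Omega> f g" "weak_grad \<Omega> f h" "g \<in> L2 \<Omega>" "h \<in> L2 \<Omega>"
  shows "AE x in lebesgue_on \<Omega>. g x = h x"
proof -
  have "AE x in lebesgue_on \<Omega>. g x $ i + (-1) *\<^sub>R h x $ i = 0" for i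
  proof -
    have L: "(\<lambda>x. g x $ i + (-1) *\<^sub>R h x $ i) \<in> L2 \<Omega>" using assms by (intro L2_comb L2_component)
    show ?thesis
    proof (rule fundamental_lemma_calculus_of_variations[OF op L2_integrable[OF L]])
      fix \<phi> assume "test_fun \<Omega> \<phi>"
      then show "ip \<Omega> (\<lambda>x. g x $ i + (-1) *\<^sub>R h x $ i) \<phi> = 0"
        using assms by (subst ip_comb) (auto simp: weak_grad_def test_fun_L2 L2_component)
    qed
  qed
  then have "AE x in lebesgue_on \<Omega>. \<forall>i\<in>UNIV. g x $ i + (-1) *\<^sub>R h x $ i = 0"
    by (subst AE_ball_countable) (auto simp: countable_finite)
  then show ?thesis by eventually_elim (simp add: vec_eq_iff)
qed

lemma weak_grad_comb:
  assumes "weak_grad \<Omega> v g" "weak_grad \<Omega> w h" "v \<in> L2 \<Omega>" "w \<in> L2 \<Omega>" "g \<in> L2 \<Omega>" "h \<in> L2 \<Omega>"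
  shows "weak_grad \<Omega> (\<lambda>x. v x + c *\<^sub>R w x) (\<lambda>x. g x + c *\<^sub>R h x)"
  unfolding weak_grad_def
proof (intro allI impI)
  fix \<phi> i assume \<phi>: "test_fun \<Omega> \<phi>"
  then have "ip \<Omega> (\<lambda>x. v x + c *\<^sub>R w x) (\<lambda>x. nabla \<phi> x $ i)
      = - ip \<Omega> (\<lambda>x. g x $ i) \<phi> + c * - ip \<Omega> (\<lambda>x. h x $ i) \<phi>"
    using assms by (subst ip_comb) (auto simp: weak_grad_def intro: L2_component test_fun_L2)
  also have "\<dots> = - (ip \<Omega> (\<lambda>x. g x $ i) \<phi> + c * ip \<Omega> (\<lambda>x. h x $ i) \<phi>)" by simp
  also have "ip \<Omega> (\<lambda>x. g x $ i) \<phi> + c * ip \<Omega> (\<lambda>x. h x $ i) \<phi> = ip \<Omega> (\<lambda>x. g x $ i + c *\<^sub>R h x $ i) \<phi>"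
    using assms \<phi> by (subst ip_comb) (auto intro: L2_component test_fun_L2)
  finally show "ip \<Omega> (\<lambda>x. v x + c *\<^sub>R w x) (\<lambda>x. nabla \<phi> x $ i)
      = - ip \<Omega> (\<lambda>x. (g x + c *\<^sub>R h x) $ i) \<phi>" by simp
qed

lemma grad_props:
  assumes "f \<in> H1 \<Omega>"
  shows "grad \<Omega> f \<in> L2 \<Omega>" "weak_grad \<Omega> f (grad \<Omega> f)"
  using someI_ex[of "\<lambda>g. g \<in> L2 \<Omega> \<and> weak_grad \<Omega> f g"] assms
  by (auto simp: H1_def grad_def)

lemma grad_eqI:
  assumes "f \<in> L2 \<Omega>" "weak_grad \<Omega> f g" "g \<in> L2 \<Omega>"
  shows "AE x in lebesgue_on \<Omega>. grad \<Omega> f x = g x"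
  using assms weak_grad_unique[OF grad_props(2) assms(2) grad_props(1)] by (auto simp: H1_def)

lemma grad_comb:
  assumes "f \<in> H1 \<Omega>" "g \<in> H1 \<Omega>"
  shows "AE x in lebesgue_on \<Omega>. grad \<Omega> (\<lambda>x. f x + c *\<^sub>R g x) x = grad \<Omega> f x + c *\<^sub>R grad \<Omega> g x"
  using assms by (intro grad_eqI weak_grad_comb L2_comb grad_props) (auto simp: H1_def)

lemma grad_ae_zero:
  assumes "f \<in> L2 \<Omega>" "ae_zero \<Omega> f"
  shows "ae_zero \<Omega> (grad \<Omega> f)"
proof -
  have "weak_grad \<Omega> f (\<lambda>x. 0)"
    unfolding weak_grad_def
    using assms ip_cong[where f=f and f'="\<lambda>x. 0"] by (auto simp: ae_zero_def L2_zero L2_component test_fun_L2 ip_def)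
  with grad_eqI[OF assms(1) this L2_zero] show ?thesis by (simp add: ae_zero_def)
qed

lemma H1v_L2: "u \<in> H1v \<Omega> \<Longrightarrow> u \<in> L2 \<Omega>"
  by (rule L2_vec) (simp add: H1v_def H1_def)

lemma jac_L2: "u \<in> H1v \<Omega> \<Longrightarrow> jac \<Omega> u \<in> L2 \<Omega>"
  by (rule L2_vec) (simp add: jac_def H1v_def grad_props)

lemma jac_comb:
  assumes "u \<in> H1v \<Omega>" "v \<in> H1v \<Omega>"
  shows "AE x in lebesgue_on \<Omega>. jac \<Omega> (\<lambda>x. u x + c *\<^sub>R v x) x = jac \<Omega> u x + c *\<^sub>R jac \<Omega> v x"
proof -
  have "AE x in lebesgue_on \<Omega>. \<forall>i\<in>UNIV. grad \<Omega> (\<lambda>x. u x $ i + c *\<^sub>R v x $ i) x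
      = grad \<Omega> (\<lambda>x. u x $ i) x + c *\<^sub>R grad \<Omega> (\<lambda>x. v x $ i) x"
    using assms grad_comb by (subst AE_ball_countable) (auto simp: countable_finite H1v_def)
  then show ?thesis by eventually_elim (simp add: jac_def vec_eq_iff)
qed

lemma jac_ae_zero:
  assumes "u \<in> H1v \<Omega>" "ae_zero \<Omega> u"
  shows "ae_zero \<Omega> (jac \<Omega> u)"
proof -
  have "ae_zero \<Omega> (grad \<Omega> (\<lambda>x. u x $ i))" for i
    using assms by (intro grad_ae_zero L2_component H1v_L2) (auto simp: ae_zero_def elim: eventually_mono)
  then have "AE x in lebesgue_on \<Omega>. \<forall>i\<in>UNIV. grad \<Omega> (\<lambda>x. u x $ i) x = 0"
    by (subst AE_ball_countable) (auto simp: countable_finite ae_zero_def)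
  then show ?thesis unfolding ae_zero_def by eventually_elim (simp add: jac_def vec_eq_iff)
qed

lemma linear_transpose: "linear (transpose :: real^'n^'m \<Rightarrow> real^'m^'n)"
  by (auto simp: linear_iff transpose_def vec_eq_iff)

lemma strain_L2:
  assumes "u \<in> H1v \<Omega>"
  shows "strain \<Omega> u \<in> L2 \<Omega>"
proof -
  have "(\<lambda>x. (1/2) *\<^sub>R (jac \<Omega> u x + 1 *\<^sub>R transpose (jac \<Omega> u x))) \<in> L2 \<Omega>"
    using assms
    by (intro L2_scale L2_comb jac_L2
        L2_bounded_linear[OF linear_conv_bounded_linear[THEN iffD1, OF linear_transpose]])
  then show ?thesis by (simp add: strain_def[abs_def])
qed

lemma strain_comb:
  assumes "u \<in> H1v \<Omega>" "v \<in> H1v \<Omega>"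
  shows "AE x in lebesgue_on \<Omega>. strain \<Omega> (\<lambda>x. u x + c *\<^sub>R v x) x = strain \<Omega> u x + c *\<^sub>R strain \<Omega> v x"
  using jac_comb[OF assms, of c]
  by eventually_elim (simp add: strain_def transpose_def vec_eq_iff algebra_simps)

lemma strain_ae_zero:
  assumes "u \<in> H1v \<Omega>" "ae_zero \<Omega> u"
  shows "ae_zero \<Omega> (strain \<Omega> u)"
  using jac_ae_zero[OF assms] unfolding ae_zero_def
  by eventually_elim (simp add: strain_def transpose_def vec_eq_iff)

text \<open>The trace of the weak Jacobian is a weak divergence.\<close>

lemma H1v_Hdiv:
  assumes "u \<in> H1v \<Omega>"
  shows "u \<in> Hdiv \<Omega>"
proof -
  let ?g = "\<lambda>i. grad \<Omega> (\<lambda>x. u x $ i)"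
  have g: "?g i \<in> L2 \<Omega>" "weak_grad \<Omega> (\<lambda>x. u x $ i) (?g i)" for i
    using assms by (auto simp: H1v_def grad_props)
  have "weak_div \<Omega> u (\<lambda>x. \<Sum>i\<in>UNIV. ?g i x $ i)"
    unfolding weak_div_def
  proof (intro allI impI)
    fix \<phi> assume \<phi>: "test_fun \<Omega> \<phi>"
    have "ip \<Omega> u (nabla \<phi>) = (\<Sum>i\<in>UNIV. - ip \<Omega> (\<lambda>x. ?g i x $ i) \<phi>)"
      using g(2) \<phi> by (subst ip_components) (auto simp: weak_grad_def test_fun_L2 H1v_L2 assms)
    also have "(\<Sum>i\<in>UNIV. - ip \<Omega> (\<lambda>x. ?g i x $ i) \<phi>) = - ip \<Omega> (\<lambda>x. \<Sum>i\<in>UNIV. ?g i x $ i) \<phi>"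
      unfolding ip_def inner_sum_left sum_negf
      by (subst Bochner_Integration.integral_sum)
         (rule L2_inner_integrable[OF L2_component[OF g(1)] test_fun_L2(1)[OF \<phi>]], simp)
    finally show "ip \<Omega> u (nabla \<phi>) = - ip \<Omega> (\<lambda>x. \<Sum>i\<in>UNIV. ?g i x $ i) \<phi>" .
  qed
  moreover have "(\<lambda>x. \<Sum>i\<in>UNIV. ?g i x $ i) \<in> L2 \<Omega>"
    by (intro L2_sum L2_component g)
  ultimately show ?thesis using H1v_L2[OF assms] by (auto simp: Hdiv_def)
qed

end

section \<open>Semi-inner products on function spaces\<close>

text \<open>Functions that agree almost everywhere are not identified, and the discrete spaces are only
subsets of a function type. The forms of the Biot system are therefore handled as positive
semidefinite symmetric bilinear forms on a set of functions closed under \<open>f + c g\<close>.\<close>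

locale semi_inner_space =
  fixes S :: "('a \<Rightarrow> 'b::real_vector) set" and b :: "('a \<Rightarrow> 'b) \<Rightarrow> ('a \<Rightarrow> 'b) \<Rightarrow> real"
  assumes comb_closed: "f \<in> S \<Longrightarrow> g \<in> S \<Longrightarrow> (\<lambda>x. f x + c *\<^sub>R g x) \<in> S"
    and comb_left: "f \<in> S \<Longrightarrow> g \<in> S \<Longrightarrow> h \<in> S \<Longrightarrow> b (\<lambda>x. f x + c *\<^sub>R g x) h = b f h + c * b g h"
    and sym: "f \<in> S \<Longrightarrow> g \<in> S \<Longrightarrow> b f g = b g f"
    and nonneg: "f \<in> S \<Longrightarrow> b f f \<ge> 0"
begin

lemma comb_right:
  assumes "f \<in> S" "g \<in> S" "h \<in> S"
  shows "b h (\<lambda>x. f x + c *\<^sub>R g x) = b h f + c * b h g"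
  using assms by (simp add: sym[of h] comb_closed comb_left)

lemma comb_self:
  assumes "f \<in> S" "g \<in> S"
  shows "b (\<lambda>x. f x + c *\<^sub>R g x) (\<lambda>x. f x + c *\<^sub>R g x) = b f f + 2 * c * b f g + c\<^sup>2 * b g g"
  using assms by (simp add: comb_closed comb_left comb_right sym[of g f] power2_eq_square algebra_simps)

text \<open>The quadratic \<open>c \<mapsto> b (f + c g) (f + c g)\<close> is nonnegative; when \<open>b g g = 0\<close> it is affine,
so its slope must vanish.\<close>

lemma Cauchy_Schwarz_sq:
  assumes "f \<in> S" "g \<in> S"
  shows "(b f g)\<^sup>2 \<le> b f f * b g g"
proof -
  have q: "0 \<le> b f f + 2 * c * b f g + c\<^sup>2 * b g g" for c
    using nonneg[OF comb_closed[OF assms, of c]] comb_self[OF assms, of c] by simp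
  show ?thesis
  proof (cases "b g g = 0")
    case True
    have "b f g = 0"
    proof (rule ccontr)
      assume nz: "b f g \<noteq> 0"
      have "0 \<le> b f f + 2 * (- (b f f + 1) / (2 * b f g)) * b f g"
        using q[of "- (b f f + 1) / (2 * b f g)"] True by simp
      also have "\<dots> = -1" using nz by (simp add: field_simps)
      finally show False by simp
    qed
    then show ?thesis using True by simp
  next
    case False
    then have pos: "b g g > 0" using nonneg[OF assms(2)] by simp
    have "0 \<le> b f f - (b f g)\<^sup>2 / b g g"
      using q[of "- b f g / b g g"] pos by (simp add: field_simps power2_eq_square)
    then show ?thesis using pos by (simp add: field_simps)
  qed
qed

text \<open>The parallelogram law with one of the two squares dropped.\<close>

lemma comb_self_le:
  assumes "f \<in> S" "g \<in> S"
  shows "b (\<lambda>x. f x + c *\<^sub>R g x) (\<lambda>x. f x + c *\<^sub>R g x) \<le> 2 * b f f + 2 * (c\<^sup>2 * b g g)"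
proof -
  have "0 \<le> b f f + 2 * (- c) * b f g + (- c)\<^sup>2 * b g g"
    using nonneg[OF comb_closed[OF assms, of "- c"]] comb_self[OF assms, of "- c"] by linarith
  then show ?thesis unfolding comb_self[OF assms, of c] by (simp add: algebra_simps)
qed

text \<open>Gram-Schmidt without linear independence. Instead of requiring the projection of \<open>f\<close> to be a
combination of the elements of \<open>B\<close>, the induction carries along the weaker property that it is
annihilated by everything orthogonal to \<open>B\<close>; this suffices to correct a projection onto \<open>B\<close> by a
multiple of the component \<open>e'\<close> of a new element \<open>e\<close> orthogonal to \<open>B\<close>.\<close>

lemma projection_exists:
  assumes "finite B" "B \<subseteq> T" "T \<subseteq> S" "(\<lambda>x. 0) \<in> T" "f \<in> S"
    and T: "\<And>f g c. f \<in> T \<Longrightarrow> g \<in> T \<Longrightarrow> (\<lambda>x. f x + c *\<^sub>R g x) \<in> T"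
  shows "\<exists>p\<in>T. (\<forall>h\<in>S. (\<forall>g\<in>B. b g h = 0) \<longrightarrow> b p h = 0) \<and> (\<forall>g\<in>B. b f g = b p g)"
  using assms(1,2,5)
proof (induction B arbitrary: f)
  case empty
  have zero: "b (\<lambda>x. 0) h = 0" if "h \<in> S" for h
    using comb_left[of "\<lambda>x. 0" "\<lambda>x. 0" h 1] that assms by auto
  show ?case using assms zero by (intro bexI[of _ "\<lambda>x. 0"]) auto
next
  case (insert e B)
  obtain p where p: "p \<in> T" "\<forall>h\<in>S. (\<forall>g\<in>B. b g h = 0) \<longrightarrow> b p h = 0" "\<forall>g\<in>B. b f g = b p g"
    using insert.IH[of f] insert.prems by blast
  obtain p' where p': "p' \<in> T" "\<forall>h\<in>S. (\<forall>g\<in>B. b g h = 0) \<longrightarrow> b p' h = 0" "\<forall>g\<in>B. b e g = b p' g"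
    using insert.IH[of e] insert.prems assms(3) by blast
  define e' where "e' = (\<lambda>x. e x + (-1) *\<^sub>R p' x)"
  have e: "e \<in> T" "e \<in> S" and BS: "\<And>g. g \<in> B \<Longrightarrow> g \<in> S"
    using insert.prems assms(3) by auto
  have "e' \<in> T" unfolding e'_def by (rule T[OF e(1) p'(1)])
  then have S: "p \<in> S" "p' \<in> S" "e' \<in> T" "e' \<in> S"
    using p p' assms(3) by auto
  have e'B: "b e' g = 0" if "g \<in> B" for g
    using p'(3) that comb_left[OF e(2) S(2) BS[OF that], of "-1"] by (simp add: e'_def)
  have e'p: "b q e' = 0" if "q = p \<or> q = p'" for q
    using p(2) p'(2) that S e'B BS by (auto simp: sym)
  have e'e: "b e' e = b e' e'"
  proof -
    have "b e' e' = b e' e - b e' p'"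
      using comb_right[OF e(2) S(2) S(4), of "-1", folded e'_def] by simp
    then show ?thesis using e'p[of p'] sym[of e' p'] S by simp
  qed
  \<comment> \<open>If \<open>e'\<close> is null then division by zero yields \<open>c = 0\<close>, and \<open>b f e'\<close> vanishes by Cauchy-Schwarz.\<close>
  define c where "c = b f e' / b e' e'"
  have c: "b f e' = c * b e' e'"
  proof (cases "b e' e' = 0")
    case True
    then show ?thesis using Cauchy_Schwarz_sq[OF insert.prems(2) S(4)] by simp
  qed (simp add: c_def)
  let ?q = "\<lambda>x. p x + c *\<^sub>R e' x"
  have q: "?q \<in> T" using p S by (intro T) auto
  have fe': "b f e = b f e' + b f p'"
    using comb_right[OF e(2) S(2) insert.prems(2), of "-1", folded e'_def] by simp
  show ?case
  proof (intro bexI[OF _ q] conjI ballI impI)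
    fix h assume h: "h \<in> S" "\<forall>g\<in>insert e B. b g h = 0"
    then show "b ?q h = 0"
      using p(2) p'(2) comb_left[OF e(2) S(2) h(1), of "-1", folded e'_def] by (simp add: comb_left S)
  next
    fix g assume g: "g \<in> insert e B"
    show "b f g = b ?q g"
    proof (cases "g = e")
      case True
      have "b (\<lambda>x. f x + (-1) *\<^sub>R p x) g = 0" if "g \<in> B" for g
        using p(3) that comb_left[OF insert.prems(2) S(1) BS[OF that], of "-1"] by simp
      then have "b p' (\<lambda>x. f x + (-1) *\<^sub>R p x) = 0"
        using p'(2) S insert.prems BS comb_closed[OF insert.prems(2) S(1), of "-1"] by (auto simp: sym)
      then have "b p' f = b p' p"
        using comb_right[OF insert.prems(2) S(1) S(2), of "-1"] by simp
      then have fp': "b f p' = b p p'" using S insert.prems by (simp add: sym)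
      have "b p e = b p e' + b p p'"
        using comb_right[OF e(2) S(2) S(1), of "-1", folded e'_def] by simp
      then show ?thesis
        using True fe' fp' e'p[of p] c e'e by (simp add: comb_left S e)
    next
      case False
      then show ?thesis using g p(3) e'B BS by (simp add: comb_left S)
    qed
  qed
qed

end

lemma semi_inner_ip: "semi_inner_space (L2 \<Omega>) (ip \<Omega>)"
  by standard (auto intro: L2_comb ip_comb ip_commute ip_nonneg simp del: real_scaleR_def)

lemma semi_inner_add:
  assumes "semi_inner_space S b1" "semi_inner_space S b2" "a1 \<ge> 0" "a2 \<ge> 0"
  shows "semi_inner_space S (\<lambda>f g. a1 * b1 f g + a2 * b2 f g)"
proof -
  interpret s1: semi_inner_space S b1 by fact
  interpret s2: semi_inner_space S b2 by fact
  show ?thesis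
    using assms(3,4)
    by unfold_locales
       (auto simp: s1.comb_closed s1.comb_left s2.comb_left s1.sym s2.sym s1.nonneg s2.nonneg algebra_simps
         simp del: real_scaleR_def)
qed

lemma semi_inner_subset:
  assumes "semi_inner_space S b" "T \<subseteq> S"
    and "\<And>f g c. f \<in> T \<Longrightarrow> g \<in> T \<Longrightarrow> (\<lambda>x. f x + c *\<^sub>R g x) \<in> T"
  shows "semi_inner_space T b"
proof -
  interpret semi_inner_space S b by fact
  show ?thesis
    by unfold_locales (use assms(2,3) in \<open>auto simp: comb_left subset_iff sym nonneg\<close>)
qed

text \<open>Operators such as the strain are linear only up to null sets, which the inner product ignores.\<close>

lemma semi_inner_pullback:
  assumes A: "\<And>f. f \<in> T \<Longrightarrow> A f \<in> L2 \<Omega>"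
    and lin: "\<And>f g c. f \<in> T \<Longrightarrow> g \<in> T \<Longrightarrow>
        AE x in lebesgue_on \<Omega>. A (\<lambda>x. f x + c *\<^sub>R g x) x = A f x + c *\<^sub>R A g x"
    and T: "\<And>f g c. f \<in> T \<Longrightarrow> g \<in> T \<Longrightarrow> (\<lambda>x. f x + c *\<^sub>R g x) \<in> T"
  shows "semi_inner_space T (\<lambda>f g. ip \<Omega> (A f) (A g))"
proof
  fix f g h c assume f: "f \<in> T" "g \<in> T" "h \<in> T"
  have "ip \<Omega> (A (\<lambda>x. f x + c *\<^sub>R g x)) (A h) = ip \<Omega> (\<lambda>x. A f x + c *\<^sub>R A g x) (A h)"
    using f by (intro ip_cong lin A T L2_comb)
  also have "\<dots> = ip \<Omega> (A f) (A h) + c * ip \<Omega> (A g) (A h)"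
    using f by (intro ip_comb A)
  finally show "ip \<Omega> (A (\<lambda>x. f x + c *\<^sub>R g x)) (A h) = ip \<Omega> (A f) (A h) + c * ip \<Omega> (A g) (A h)" .
qed (auto intro: T ip_commute ip_nonneg)

section \<open>Finite element spaces and the \<open>L\<^sup>2\<close> projection\<close>

lemma fe_space_comb:
  assumes "fe_space \<Omega> S" "f \<in> S" "g \<in> S"
  shows "(\<lambda>x. f x + c *\<^sub>R g x) \<in> S"
proof -
  have "(\<lambda>x. c *\<^sub>R g x) \<in> S" using assms(1,3) by (simp add: fe_space_def)
  then show ?thesis using assms(1,2) by (simp add: fe_space_def)
qed

lemma fe_space_zero: "fe_space \<Omega> S \<Longrightarrow> (\<lambda>x. 0) \<in> S"
  by (simp add: fe_space_def)

lemma ip_sum_left: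
  assumes "\<And>i. i \<in> I \<Longrightarrow> f i \<in> L2 \<Omega>" "g \<in> L2 \<Omega>"
  shows "ip \<Omega> (\<lambda>x. \<Sum>i\<in>I. c i *\<^sub>R f i x) g = (\<Sum>i\<in>I. c i * ip \<Omega> (f i) g)"
proof -
  have "ip \<Omega> (\<lambda>x. \<Sum>i\<in>I. c i *\<^sub>R f i x) g = (\<Sum>i\<in>I. ip \<Omega> (\<lambda>x. c i *\<^sub>R f i x) g)"
    unfolding ip_def inner_sum_left
    using assms by (intro Bochner_Integration.integral_sum L2_inner_integrable L2_scale)
  then show ?thesis by (simp add: ip_def)
qed

text \<open>The space is spanned by a finite set up to null functions, so orthogonality to that set is
orthogonality to the whole space, and the projection exists.\<close>

lemma L2_proj:
  assumes Q: "fe_space \<Omega> Q" "Q \<subseteq> L2 \<Omega>" and f: "f \<in> L2 \<Omega>"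
  shows "L2_proj \<Omega> Q f \<in> Q" "\<And>q. q \<in> Q \<Longrightarrow> ip \<Omega> (L2_proj \<Omega> Q f) q = ip \<Omega> f q"
proof -
  interpret semi_inner_space "L2 \<Omega>" "ip \<Omega> :: (real^'a \<Rightarrow> real) \<Rightarrow> _" by (rule semi_inner_ip)
  obtain B where B: "finite B" "B \<subseteq> Q"
    "\<And>f. f \<in> Q \<Longrightarrow> \<exists>c. AE x in lebesgue_on \<Omega>. f x = (\<Sum>b\<in>B. c b *\<^sub>R b x)"
    using Q by (auto simp: fe_space_def)
  obtain p where p: "p \<in> Q" "\<And>g. g \<in> B \<Longrightarrow> ip \<Omega> f g = ip \<Omega> p g"
    using projection_exists[OF B(1,2) Q(2) fe_space_zero[OF Q(1)] f fe_space_comb[OF Q(1)]] by blast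
  define r where "r = (\<lambda>x. f x + (-1) *\<^sub>R p x)"
  have r: "r \<in> L2 \<Omega>" unfolding r_def using f p Q by (intro L2_comb) auto
  have rB: "ip \<Omega> g r = 0" if "g \<in> B" for g
  proof -
    have "ip \<Omega> r g = ip \<Omega> f g + (-1) * ip \<Omega> p g"
      unfolding r_def using f p Q B that by (intro ip_comb) auto
    then show ?thesis using p(2)[OF that] by (simp add: ip_commute)
  qed
  have "ip \<Omega> r q = 0" if q: "q \<in> Q" for q
  proof -
    obtain c where c: "AE x in lebesgue_on \<Omega>. q x = (\<Sum>b\<in>B. c b *\<^sub>R b x)" using B(3)[OF q] by blast
    have "ip \<Omega> q r = ip \<Omega> (\<lambda>x. \<Sum>b\<in>B. c b *\<^sub>R b x) r"
      using q Q B by (intro ip_cong c r L2_sum L2_scale) auto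
    also have "\<dots> = 0" using Q B r rB by (subst ip_sum_left) auto
    finally show ?thesis by (simp add: ip_commute)
  qed
  then have "\<exists>p. p \<in> Q \<and> (\<forall>q\<in>Q. ip \<Omega> (\<lambda>x. f x - p x) q = 0)"
    using p(1) by (auto simp: r_def)
  from someI_ex[OF this] have P: "L2_proj \<Omega> Q f \<in> Q" "\<forall>q\<in>Q. ip \<Omega> (\<lambda>x. f x - L2_proj \<Omega> Q f x) q = 0"
    unfolding L2_proj_def by blast+
  show "L2_proj \<Omega> Q f \<in> Q" by fact
  fix q assume q: "q \<in> Q"
  have "ip \<Omega> (\<lambda>x. f x + (-1) *\<^sub>R L2_proj \<Omega> Q f x) q = ip \<Omega> f q + (-1) * ip \<Omega> (L2_proj \<Omega> Q f) q"
    using f P Q q by (intro ip_comb) auto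
  then show "ip \<Omega> (L2_proj \<Omega> Q f) q = ip \<Omega> f q" using P(2) q by simp
qed

lemma L2_proj_comb:
  assumes Q: "fe_space \<Omega> Q" "Q \<subseteq> L2 \<Omega>" and f: "f \<in> L2 \<Omega>" and g: "g \<in> L2 \<Omega>"
    and h: "h \<in> L2 \<Omega>" "AE x in lebesgue_on \<Omega>. h x = f x + c *\<^sub>R g x" and q: "q \<in> Q"
  shows "ip \<Omega> (L2_proj \<Omega> Q h) q = ip \<Omega> (L2_proj \<Omega> Q f) q + c * ip \<Omega> (L2_proj \<Omega> Q g) q"
proof -
  have "ip \<Omega> h q = ip \<Omega> (\<lambda>x. f x + c *\<^sub>R g x) q"
    using Q q by (intro ip_cong h L2_comb f g) auto
  also have "\<dots> = ip \<Omega> f q + c * ip \<Omega> g q" using Q q by (intro ip_comb f g) auto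
  finally show ?thesis using L2_proj(2)[OF Q _ q] f g h by simp
qed

lemma L2_proj_norm_le:
  assumes Q: "fe_space \<Omega> Q" "Q \<subseteq> L2 \<Omega>" and f: "f \<in> L2 \<Omega>"
  shows "ip \<Omega> (L2_proj \<Omega> Q f) (L2_proj \<Omega> Q f) \<le> ip \<Omega> f f"
proof -
  let ?p = "L2_proj \<Omega> Q f"
  interpret semi_inner_space "L2 \<Omega>" "ip \<Omega> :: (real^'a \<Rightarrow> real) \<Rightarrow> _" by (rule semi_inner_ip)
  have p: "?p \<in> L2 \<Omega>" "ip \<Omega> f ?p = ip \<Omega> ?p ?p" using L2_proj[OF Q f] Q by auto
  have "0 \<le> ip \<Omega> f f + 2 * (-1) * ip \<Omega> f ?p + (-1)\<^sup>2 * ip \<Omega> ?p ?p"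
    using nonneg[OF comb_closed[OF f p(1), of "-1"]] comb_self[OF f p(1), of "-1"] by linarith
  then show ?thesis using p by simp
qed

section \<open>The Darcy form\<close>

text \<open>The estimates come from testing coercivity of \<open>A\<close> with \<open>\<xi> = A\<^sup>-\<^sup>1 y\<close>.\<close>

lemma coercive_symmetric_matrix_inv:
  fixes A :: "real^'n^'n"
  assumes sym: "transpose A = A" and k: "k > 0" and co: "\<And>\<xi>. k * (\<xi> \<bullet> \<xi>) \<le> \<xi> \<bullet> (A *v \<xi>)"
  shows "det A \<noteq> 0" "A *v (matrix_inv A *v y) = y"
    and "(matrix_inv A *v x) \<bullet> y = (matrix_inv A *v y) \<bullet> x"
    and "k * norm (matrix_inv A *v y) \<le> norm y"
    and "k * (norm (matrix_inv A *v y))\<^sup>2 \<le> (matrix_inv A *v y) \<bullet> y"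
proof -
  have ker: "\<xi> = 0" if "A *v \<xi> = 0" for \<xi>
  proof -
    have "\<xi> \<bullet> \<xi> \<le> 0" using co[of \<xi>] that k by (simp add: mult_le_0_iff)
    then show ?thesis by (metis inner_eq_zero_iff inner_ge_zero order_antisym)
  qed
  have "\<exists>B. B ** A = mat 1" using ker by (simp add: matrix_left_invertible_ker)
  then have inv: "invertible A" using invertible_left_inverse by blast
  then show "det A \<noteq> 0" by (simp add: invertible_det_nz)
  have I: "A ** matrix_inv A = mat 1"
    using inv someI_ex[of "\<lambda>A'. A ** A' = mat 1 \<and> A' ** A = mat 1"]
    by (auto simp: invertible_def matrix_inv_def)
  show y: "A *v (matrix_inv A *v y) = y" for y
    by (simp add: matrix_vector_mul_assoc I)
  have sa: "(A *v u) \<bullet> v = u \<bullet> (A *v v)" for u v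
    using dot_lmul_matrix[of u A v] transpose_matrix_vector[of A u] sym by simp
  show "(matrix_inv A *v x) \<bullet> y = (matrix_inv A *v y) \<bullet> x"
    using sa[of "matrix_inv A *v x" "matrix_inv A *v y"] y by (metis inner_commute)
  show c: "k * (norm (matrix_inv A *v y))\<^sup>2 \<le> (matrix_inv A *v y) \<bullet> y"
    using co[of "matrix_inv A *v y"] y[of y] by (simp add: power2_norm_eq_inner)
  show "k * norm (matrix_inv A *v y) \<le> norm y"
  proof (cases "matrix_inv A *v y = 0")
    case False
    have "norm (matrix_inv A *v y) * (k * norm (matrix_inv A *v y)) \<le> norm (matrix_inv A *v y) * norm y"
      using c norm_cauchy_schwarz[of "matrix_inv A *v y" y] by (simp add: power2_eq_square algebra_simps)
    then show ?thesis using False by simp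
  qed simp
qed

text \<open>Cramer's rule expresses the solution of a linear system by determinants, which are polynomials in
the measurable entries.\<close>

lemma matrix_inv_mult_measurable:
  fixes K :: "'a \<Rightarrow> real^'n^'n" and w :: "'a \<Rightarrow> real^'n"
  assumes K: "K \<in> borel_measurable N" and w: "w \<in> borel_measurable N"
    and inv: "\<And>x. x \<in> space N \<Longrightarrow> det (K x) \<noteq> 0 \<and> K x *v (matrix_inv (K x) *v w x) = w x"
  shows "(\<lambda>x. matrix_inv (K x) *v w x) \<in> borel_measurable N"
proof -
  have Kij: "(\<lambda>x. K x $ i $ j) \<in> borel_measurable N" for i j
    by (intro borel_measurable_continuous_on[OF _ K, where f="\<lambda>A. A $ i $ j"] continuous_intros)
  have wi: "(\<lambda>x. w x $ i) \<in> borel_measurable N" for i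
    by (intro borel_measurable_continuous_on[OF _ w, where f="\<lambda>A. A $ i"] continuous_intros)
  have det: "(\<lambda>x. det (F x)) \<in> borel_measurable N"
    if "\<And>i j. (\<lambda>x. F x $ i $ j) \<in> borel_measurable N" for F :: "'a \<Rightarrow> real^'n^'n"
    unfolding det_def using that
    by (intro borel_measurable_sum borel_measurable_times borel_measurable_prod borel_measurable_const)
  let ?c = "\<lambda>x. (\<chi> k. det (\<chi> i j. if j = k then w x $ i else K x $ i $ j) / det (K x))"
  have "(\<lambda>x. ?c x $ k) \<in> borel_measurable N" for k
  proof -
    have "(\<lambda>x. det (\<chi> i j. if j = k then w x $ i else K x $ i $ j)) \<in> borel_measurable N"
    proof (rule det)
      fix i j
      show "(\<lambda>x. (\<chi> i j. if j = k then w x $ i else K x $ i $ j) $ i $ j) \<in> borel_measurable N"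
        by (cases "j = k") (simp_all add: Kij wi)
    qed
    then show ?thesis using det[of K, OF Kij] by simp
  qed
  then have "?c \<in> borel_measurable N"
    by (subst borel_measurable_euclidean_space) (auto simp: Basis_vec_def inner_axis)
  moreover have "?c x = matrix_inv (K x) *v w x" if "x \<in> space N" for x
    using inv[OF that] cramer[of "K x" "matrix_inv (K x) *v w x" "w x"] by argo
  then have "?c \<in> borel_measurable N \<longleftrightarrow> (\<lambda>x. matrix_inv (K x) *v w x) \<in> borel_measurable N"
    by (rule measurable_cong)
  ultimately show ?thesis by simp
qed

text \<open>Uniform positivity of \<open>K\<close> makes \<open>K\<^sup>-\<^sup>1\<close> a bounded field, so that the integrand is integrable, and
it makes the form definite.\<close>

lemma Darcy_semi_inner:
  assumes perm: "permeability \<Omega> K" and \<mu>f: "\<mu>f > 0" and op: "open \<Omega>"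
  shows "semi_inner_space (L2 \<Omega>) (darcy \<Omega> K \<mu>f)"
    and "\<And>w. w \<in> L2 \<Omega> \<Longrightarrow> darcy \<Omega> K \<mu>f w w = 0 \<Longrightarrow> ae_zero \<Omega> w"
proof -
  obtain k0 where k0: "k0 > 0" "\<And>x \<xi>. x \<in> \<Omega> \<Longrightarrow> k0 * (\<xi> \<bullet> \<xi>) \<le> \<xi> \<bullet> (K x *v \<xi>)"
    using perm unfolding permeability_def by blast
  have Ks: "\<And>x. x \<in> \<Omega> \<Longrightarrow> transpose (K x) = K x" using perm by (simp add: permeability_def)
  note inv = coercive_symmetric_matrix_inv[OF Ks k0(1) k0(2)]
  have sp: "space (lebesgue_on \<Omega>) = \<Omega>" by simp
  define F where "F w = (\<lambda>x. matrix_inv (K x) *v (\<mu>f *\<^sub>R w x))" for w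
  have F: "F w \<in> L2 \<Omega>" if w: "w \<in> L2 \<Omega>" for w
  proof -
    have m: "F w \<in> borel_measurable (lebesgue_on \<Omega>)"
      unfolding F_def
    proof (rule matrix_inv_mult_measurable)
      show "K \<in> borel_measurable (lebesgue_on \<Omega>)" using perm by (simp add: permeability_def)
      show "(\<lambda>x. \<mu>f *\<^sub>R w x) \<in> borel_measurable (lebesgue_on \<Omega>)" by (intro L2_measurable L2_scale w)
    qed (use inv in auto)
    have "integrable (lebesgue_on \<Omega>) (\<lambda>x. (norm (F w x))\<^sup>2)"
    proof (rule Bochner_Integration.integrable_bound)
      show "integrable (lebesgue_on \<Omega>) (\<lambda>x. (\<mu>f / k0)\<^sup>2 * (norm (w x))\<^sup>2)"
        using w by (simp add: L2_def)
      show "(\<lambda>x. (norm (F w x))\<^sup>2) \<in> borel_measurable (lebesgue_on \<Omega>)" using m by simp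
      have "norm (F w x) \<le> (\<mu>f / k0) * norm (w x)" if "x \<in> \<Omega>" for x
        using inv(4)[OF that that, of "\<mu>f *\<^sub>R w x"] k0 \<mu>f
        by (simp add: F_def field_simps)
      then show "AE x in lebesgue_on \<Omega>. norm ((norm (F w x))\<^sup>2) \<le> norm ((\<mu>f / k0)\<^sup>2 * (norm (w x))\<^sup>2)"
        unfolding power_mult_distrib[symmetric]
        by (intro AE_I2) (auto intro!: power_mono)
    qed
    with m show ?thesis by (simp add: L2_def)
  qed
  have d: "darcy \<Omega> K \<mu>f w r = ip \<Omega> (F w) r" for w r by (simp add: darcy_def F_def)
  show "semi_inner_space (L2 \<Omega>) (darcy \<Omega> K \<mu>f)"
  proof
    fix f g h :: "real^'a \<Rightarrow> real^'a" and c
    assume f: "f \<in> L2 \<Omega>" and g: "g \<in> L2 \<Omega>"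
    show "(\<lambda>x. f x + c *\<^sub>R g x) \<in> L2 \<Omega>" using f g by (rule L2_comb)
    have "F (\<lambda>x. f x + c *\<^sub>R g x) = (\<lambda>x. F f x + c *\<^sub>R F g x)"
      by (simp add: F_def fun_eq_iff scaleR_right_distrib matrix_vector_right_distrib
          matrix_vector_mult_scaleR mult.commute)
    then show "h \<in> L2 \<Omega> \<Longrightarrow> darcy \<Omega> K \<mu>f (\<lambda>x. f x + c *\<^sub>R g x) h = darcy \<Omega> K \<mu>f f h + c * darcy \<Omega> K \<mu>f g h"
      using f g by (simp add: d ip_comb F)
    show "darcy \<Omega> K \<mu>f f g = darcy \<Omega> K \<mu>f g f"
      unfolding d ip_def
    proof (rule Bochner_Integration.integral_cong[OF refl])
      fix x assume "x \<in> space (lebesgue_on \<Omega>)"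
      then show "F f x \<bullet> g x = F g x \<bullet> f x"
        using inv(3)[of x "f x" "g x"] by (simp add: F_def matrix_vector_mult_scaleR)
    qed
    have "0 \<le> F f x \<bullet> f x" if "x \<in> \<Omega>" for x
    proof -
      have "0 \<le> (matrix_inv (K x) *v f x) \<bullet> f x"
        using inv(5)[OF that that, of "f x"] k0(1) by (smt (verit) mult_nonneg_nonneg zero_le_power2)
      then show ?thesis using \<mu>f by (simp add: F_def matrix_vector_mult_scaleR)
    qed
    then show "darcy \<Omega> K \<mu>f f f \<ge> 0"
      unfolding d ip_def by (intro Bochner_Integration.integral_nonneg) auto
  qed
  fix w assume w: "w \<in> L2 \<Omega>" and z: "darcy \<Omega> K \<mu>f w w = 0"
  have low: "0 \<le> F w x \<bullet> w x \<and> (F w x \<bullet> w x = 0 \<longrightarrow> w x = 0)" if x: "x \<in> \<Omega>" for x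
  proof -
    let ?e = "matrix_inv (K x) *v w x"
    have e: "k0 * (norm ?e)\<^sup>2 \<le> ?e \<bullet> w x" using inv(5)[OF x x] .
    have F': "F w x \<bullet> w x = \<mu>f * (?e \<bullet> w x)" by (simp add: F_def matrix_vector_mult_scaleR)
    have "0 \<le> k0 * (norm ?e)\<^sup>2" using k0 by simp
    then have nn: "0 \<le> ?e \<bullet> w x" using e by linarith
    have "w x = 0" if "?e \<bullet> w x = 0"
    proof -
      have "?e = 0" using e that k0 by (simp add: mult_le_0_iff)
      then show ?thesis using inv(2)[OF x x, of "w x"] by simp
    qed
    then show ?thesis using nn \<mu>f by (simp add: F')
  qed
  have "AE x in lebesgue_on \<Omega>. F w x \<bullet> w x = 0"
    using z low unfolding d ip_def
    by (subst integral_nonneg_eq_0_iff_AE[symmetric]) (auto intro!: L2_inner_integrable F w AE_I2)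
  then show "ae_zero \<Omega> w"
    unfolding ae_zero_def using AE_space by eventually_elim (use low in auto)
qed

section \<open>Discrete spaces with the stability constants\<close>

text \<open>Every mixed term \<open>T\<close> of the Biot form satisfies a Cauchy-Schwarz estimate \<open>T\<^sup>2 \<le> k A B\<close>, where \<open>A\<close>
and \<open>B\<close> are summands of the squared norms of the two arguments. Keeping these estimates squared
avoids square roots of parameters; one of the next two lemmas is applied at the end.\<close>

lemma abs_le_from_square:
  fixes T :: real
  assumes "T\<^sup>2 \<le> k * (A * B)" "0 \<le> A" "0 \<le> B" "A \<le> X\<^sup>2" "B \<le> Y\<^sup>2" "0 \<le> k" "0 \<le> X" "0 \<le> Y"
  shows "\<bar>T\<bar> \<le> sqrt k * (X * Y)"
proof -
  have "T\<^sup>2 \<le> k * (X\<^sup>2 * Y\<^sup>2)"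
    using assms(1) mult_left_mono[OF mult_mono[OF assms(4,5)], of k] assms by simp
  also have "\<dots> = (sqrt k * (X * Y))\<^sup>2" using assms by (simp add: power_mult_distrib)
  finally show ?thesis using assms by (simp add: abs_le_square_iff[symmetric])
qed

lemma abs_le_mean:
  fixes T :: real
  assumes "T\<^sup>2 \<le> P * R" "0 \<le> P" "0 \<le> R"
  shows "\<bar>T\<bar> \<le> (P + R) / 2"
proof -
  have "0 \<le> (P - R)\<^sup>2" by simp
  then have "P * R \<le> ((P + R) / 2)\<^sup>2" by (simp add: power2_eq_square field_simps)
  then have "T\<^sup>2 \<le> ((P + R) / 2)\<^sup>2" using assms by linarith
  then show ?thesis using assms by (simp add: abs_le_square_iff[symmetric])
qed

text \<open>The summation steps of the inf-sup argument: \<open>A\<close>, \<open>P\<close>, \<open>R\<close>, \<open>D\<close> stand for the energy, pressure, flux and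
divergence parts of the squared norm, and in the second lemma \<open>P1\<close> and \<open>P2\<close> are the shares \<open>\<alpha>\<^sup>2 / \<zeta>\<^sup>2\<close> and
\<open>1 / M\<close> of the pressure part, \<open>E1\<close> to \<open>E3\<close> the mixed terms to be absorbed, and \<open>- E4\<close> the gain from the
Stokes inf-sup condition.\<close>

lemma upper_bound_arith:
  fixes A P R D :: real
  assumes "0 \<le> A" "0 \<le> P" "0 \<le> R" "0 \<le> D"
  shows "2 * A + 2 * P + R + D \<le> 3 * (A + P + R + D)"
proof -
  have "3 * (A + P + R + D) = 2 * A + 2 * P + R + D + (A + P + 2 * R + 2 * D)"
    by (simp add: algebra_simps)
  moreover have "0 \<le> A + P + 2 * R + 2 * D" using assms by simp
  ultimately show ?thesis by linarith
qed

lemma lower_bound_arith: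
  fixes A P1 P2 R D E1 E2 E3 E4 l b \<eta> :: real
  assumes "\<bar>E1\<bar> \<le> b / 2 * P1 + A / 4" "\<bar>E2\<bar> \<le> \<eta> / 4 * D + A / 4"
    and "\<bar>E3\<bar> \<le> \<eta> / 4 * D + \<eta> * P2" "b * P1 \<le> - E4" "\<eta> \<le> 1 / 4"
    and nn: "0 \<le> A" "0 \<le> P1" "0 \<le> P2" "0 \<le> R" "0 \<le> D"
    and l: "l \<le> 1 / 2" "l \<le> b / 2" "l \<le> \<eta> / 2"
  shows "l * (A + (P1 + P2) + R + D) \<le> A + E1 + E2 + R + \<eta> * D + P2 + E3 - E4"
proof -
  have "l * A \<le> 1 / 2 * A" "l * P1 \<le> b / 2 * P1" "l * P2 \<le> 1 / 2 * P2" "l * R \<le> 1 / 2 * R"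
    "l * D \<le> \<eta> / 2 * D" "\<eta> * P2 \<le> 1 / 4 * P2"
    using assms by (intro mult_right_mono; simp)+
  moreover have "l * (A + (P1 + P2) + R + D) = l * A + l * P1 + l * P2 + l * R + l * D"
    by (simp add: algebra_simps)
  moreover have "E1 \<ge> - (b / 2 * P1 + A / 4)" "E2 \<ge> - (\<eta> / 4 * D + A / 4)" "E3 \<ge> - (\<eta> / 4 * D + \<eta> * P2)"
    using assms(1-3) by (simp_all only: abs_le_iff) linarith+
  ultimately show ?thesis using assms(4) nn by linarith
qed

text \<open>One mesh size of a Stokes-Biot stable family. The constants \<open>C\<close> and \<open>c\<close> come from continuity of
the elasticity form for \<open>\<lambda> = \<mu> = 1\<close> and coercivity for \<open>\<lambda> = 0\<close>, \<open>\<mu> = 1\<close>: taken at fixed Lame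
coefficients, they no longer depend on the physical parameters.\<close>

locale biot_discretization = bounded_open \<Omega> for \<Omega> :: "(real^'d) set" +
  fixes Vh Wh :: "(real^'d \<Rightarrow> real^'d) set" and Qh :: "(real^'d \<Rightarrow> real) set"
    and C c \<beta> :: real
  assumes feV: "fe_space \<Omega> Vh" and VH1: "Vh \<subseteq> H1v \<Omega>"
    and WHdiv: "Wh \<subseteq> Hdiv \<Omega>"
    and feQ: "fe_space \<Omega> Qh" and QL2: "Qh \<subseteq> L2 \<Omega>"
    and div_W: "w \<in> Wh \<Longrightarrow> \<exists>q\<in>Qh. AE x in lebesgue_on \<Omega>. dvg \<Omega> w x = q x"
    and C_pos: "C > 0" and c_pos: "c > 0" and \<beta>_pos: "\<beta> > 0"
    and strain_div_le: "v \<in> Vh \<Longrightarrow>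
        2 * ip \<Omega> (strain \<Omega> v) (strain \<Omega> v) + ip \<Omega> (dvg \<Omega> v) (dvg \<Omega> v) \<le> C * (H1v_norm \<Omega> v)\<^sup>2"
    and Korn: "v \<in> Vh \<Longrightarrow> c * (H1v_norm \<Omega> v)\<^sup>2 \<le> 2 * ip \<Omega> (strain \<Omega> v) (strain \<Omega> v)"
    and inf_sup: "p \<in> Qh \<Longrightarrow> \<exists>v\<in>Vh. \<beta> * ip \<Omega> p p \<le> ip \<Omega> (dvg \<Omega> v) p \<and> (H1v_norm \<Omega> v)\<^sup>2 \<le> ip \<Omega> p p"
begin

abbreviation Pdiv :: "(real^'d \<Rightarrow> real^'d) \<Rightarrow> real^'d \<Rightarrow> real" where
  "Pdiv v \<equiv> L2_proj \<Omega> Qh (dvg \<Omega> v)"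

lemma V_L2: "v \<in> Vh \<Longrightarrow> v \<in> L2 \<Omega>"
  using VH1 H1v_L2 by blast

lemma V_div: "v \<in> Vh \<Longrightarrow> dvg \<Omega> v \<in> L2 \<Omega>"
  using VH1 H1v_Hdiv dvg_props by blast

lemma W_L2: "w \<in> Wh \<Longrightarrow> w \<in> L2 \<Omega>"
  using WHdiv by (auto simp: Hdiv_def)

lemma W_div: "w \<in> Wh \<Longrightarrow> dvg \<Omega> w \<in> L2 \<Omega>"
  using WHdiv dvg_props by blast

lemma Q_L2: "q \<in> Qh \<Longrightarrow> q \<in> L2 \<Omega>"
  using QL2 by blast

lemma Pdiv_Q: "v \<in> Vh \<Longrightarrow> Pdiv v \<in> Qh"
  by (rule L2_proj(1)[OF feQ QL2 V_div])

lemma ip_Pdiv: "v \<in> Vh \<Longrightarrow> q \<in> Qh \<Longrightarrow> ip \<Omega> (dvg \<Omega> v) q = ip \<Omega> (Pdiv v) q"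
  by (rule L2_proj(2)[OF feQ QL2 V_div, symmetric])

lemma Pdiv_comb:
  assumes "u \<in> Vh" "v \<in> Vh" "q \<in> Qh"
  shows "ip \<Omega> (Pdiv (\<lambda>x. u x + s *\<^sub>R v x)) q = ip \<Omega> (Pdiv u) q + s * ip \<Omega> (Pdiv v) q"
  by (rule L2_proj_comb[OF feQ QL2 V_div[OF assms(1)] V_div[OF assms(2)] V_div dvg_comb assms(3)])
     (use assms VH1 H1v_Hdiv fe_space_comb[OF feV] in auto)

lemma strain_semi: "semi_inner_space Vh (\<lambda>u v. ip \<Omega> (strain \<Omega> u) (strain \<Omega> v))"
proof (rule semi_inner_pullback)
  show "strain \<Omega> f \<in> L2 \<Omega>" if "f \<in> Vh" for f using that VH1 strain_L2 by blast
  show "AE x in lebesgue_on \<Omega>. strain \<Omega> (\<lambda>x. f x + c *\<^sub>R g x) x = strain \<Omega> f x + c *\<^sub>R strain \<Omega> g x"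
    if "f \<in> Vh" "g \<in> Vh" for f g c using that VH1 strain_comb by blast
qed (rule fe_space_comb[OF feV])

lemma Pdiv_semi: "semi_inner_space Vh (\<lambda>u v. ip \<Omega> (Pdiv u) (Pdiv v))"
proof
  fix u v assume "u \<in> Vh" "v \<in> Vh"
  show "ip \<Omega> (Pdiv u) (Pdiv v) = ip \<Omega> (Pdiv v) (Pdiv u)" by (rule ip_commute)
qed (simp_all add: Pdiv_comb Pdiv_Q ip_nonneg fe_space_comb[OF feV])

lemma ip_dvg_comb:
  assumes "u \<in> Vh" "v \<in> Vh" "q \<in> Qh"
  shows "ip \<Omega> (dvg \<Omega> (\<lambda>x. u x + s *\<^sub>R v x)) q = ip \<Omega> (dvg \<Omega> u) q + s * ip \<Omega> (dvg \<Omega> v) q"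
  using assms fe_space_comb[OF feV assms(1,2)] by (simp add: ip_Pdiv Pdiv_comb)

lemma Q_Cauchy_Schwarz_sq:
  fixes f g :: "real^'d \<Rightarrow> real"
  assumes "f \<in> L2 \<Omega>" "g \<in> L2 \<Omega>"
  shows "(ip \<Omega> f g)\<^sup>2 \<le> ip \<Omega> f f * ip \<Omega> g g"
  by (rule semi_inner_space.Cauchy_Schwarz_sq[OF semi_inner_ip assms])

text \<open>\<open>\<kappa>\<close> bounds \<open>\<zeta>\<^sup>2 \<parallel>P div v\<parallel>\<^sup>2\<close> by the energy, and \<open>C2\<close> bounds the energy by \<open>\<zeta>\<^sup>2 \<parallel>v\<parallel>\<^sub>1\<^sup>2\<close>. The weights \<open>\<theta>\<close>
and \<open>\<eta>\<close> of the two corrections of the test function are chosen so small that the mixed terms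
they create use up at most half of the terms that have a sign. The remaining three are the
continuity constant and the two constants of the inf-sup argument.\<close>

definition "\<kappa> = 1 + 2 * C / c"
definition "C2 = C * real CARD('d)"
definition "\<theta> = \<beta> / (2 * C2)"
definition "\<eta> = 1 / (4 * \<kappa>)"
definition "cont_const = 5 + 2 * sqrt \<kappa>"
definition "low_const = min (1 / 2) (min (\<theta> * \<beta> / 2) (\<eta> / 2))"
definition "up_const = 3 + \<theta> * \<beta> + 2 * \<eta>\<^sup>2"

lemma const_pos:
  "\<kappa> \<ge> 1" "C2 > 0" "\<theta> > 0" "\<eta> > 0" "cont_const > 0" "low_const > 0" "up_const > 0"
proof -
  show k: "\<kappa> \<ge> 1" using C_pos c_pos by (simp add: \<kappa>_def)
  show C2: "C2 > 0" using C_pos by (simp add: C2_def)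
  show t: "\<theta> > 0" using C2 \<beta>_pos by (simp add: \<theta>_def)
  show e: "\<eta> > 0" using k by (simp add: \<eta>_def)
  show "cont_const > 0" using k by (simp add: cont_const_def add_pos_nonneg)
  show "low_const > 0" using t e \<beta>_pos by (simp add: low_const_def)
  have "0 < \<theta> * \<beta>" using t \<beta>_pos by simp
  then show "up_const > 0" using zero_le_power2[of \<eta>] unfolding up_const_def by linarith
qed

end

section \<open>Parameter-uniform bounds for the Biot form\<close>

locale biot_problem = biot_discretization \<Omega> Vh Wh Qh C c \<beta>
  for \<Omega> :: "(real^'d) set" and Vh Wh Qh C c \<beta> +
  fixes lam \<mu> \<alpha> M \<mu>f \<tau> :: real and K :: "real^'d \<Rightarrow> real^'d^'d"
  assumes lam: "lam \<ge> 0" and \<mu>: "\<mu> > 0" and \<alpha>: "\<alpha> > 0" and M: "M > 0" and \<mu>f: "\<mu>f > 0"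
    and perm: "permeability \<Omega> K" and \<tau>: "\<tau> > 0"
begin

abbreviation "a \<equiv> elast_RQ \<Omega> Qh lam \<mu>"
abbreviation "m \<equiv> darcy \<Omega> K \<mu>f"
definition "cp = c_p TYPE('d) lam \<mu> \<alpha> M"
abbreviation "\<B> \<equiv> biot_form \<Omega> Qh lam \<mu> \<alpha> M \<mu>f K \<tau>"
abbreviation "N \<equiv> norm_D \<Omega> Qh lam \<mu> \<alpha> M \<mu>f K \<tau>"
abbreviation "X \<equiv> Vh \<times> Wh \<times> Qh"

text \<open>The square of \<open>\<zeta>\<close>.\<close>

definition "z2 = lam + 2 * \<mu> / real CARD('d)"

lemma z2_pos: "z2 > 0"
  using lam \<mu> by (simp add: z2_def add_nonneg_pos)

lemma cp_inverse: "inverse cp = \<alpha>\<^sup>2 / z2 + 1 / M"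
  using z2_pos by (simp add: cp_def c_p_def zeta_def z2_def)

lemma cp_pos: "cp > 0"
proof -
  have "inverse cp > 0" unfolding cp_inverse using z2_pos \<alpha> M by (simp add: add_pos_pos)
  then show ?thesis by simp
qed

lemma a_semi: "semi_inner_space Vh a"
  using semi_inner_add[OF strain_semi Pdiv_semi, of "2 * \<mu>" lam] \<mu> lam
  by (simp add: elast_RQ_def[abs_def])

lemma m_semi: "semi_inner_space (L2 \<Omega>) m"
  by (rule Darcy_semi_inner[OF perm \<mu>f op])

text \<open>The part of \<open>\<zeta>\<^sup>2\<close> proportional to \<open>\<lambda>\<close> is covered by the reduced-quadrature term of the energy. For
the part proportional to \<open>\<mu>\<close> the divergence is controlled by the strain: continuity and Korn's
inequality give \<open>\<parallel>div v\<parallel>\<^sup>2 \<le> C \<parallel>v\<parallel>\<^sub>1\<^sup>2 \<le> (2 C / c) \<parallel>\<epsilon>(v)\<parallel>\<^sup>2\<close>.\<close>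

lemma Pdiv_le_energy:
  assumes v: "v \<in> Vh"
  shows "z2 * ip \<Omega> (Pdiv v) (Pdiv v) \<le> \<kappa> * a v v"
proof -
  let ?s = "ip \<Omega> (strain \<Omega> v) (strain \<Omega> v)" and ?b = "ip \<Omega> (Pdiv v) (Pdiv v)"
  have s0: "?s \<ge> 0" "?b \<ge> 0" by (simp_all add: ip_nonneg)
  have "?b \<le> ip \<Omega> (dvg \<Omega> v) (dvg \<Omega> v)" by (rule L2_proj_norm_le[OF feQ QL2 V_div[OF v]])
  also have "\<dots> \<le> C * (H1v_norm \<Omega> v)\<^sup>2" using strain_div_le[OF v] s0 by linarith
  also have "\<dots> \<le> C * (2 * ?s / c)"
    using Korn[OF v] C_pos c_pos by (intro mult_left_mono) (auto simp: field_simps)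
  finally have b: "?b \<le> (2 * C / c) * ?s" by (simp add: field_simps)
  have "(2 * \<mu> / real CARD('d)) * ?b \<le> (2 * \<mu>) * ?b"
    using \<mu> s0 by (intro mult_right_mono) (auto simp: field_simps)
  also have "\<dots> \<le> (2 * \<mu>) * ((2 * C / c) * ?s)" using b \<mu> by (intro mult_left_mono) auto
  also have "\<dots> = (2 * C / c) * (2 * \<mu> * ?s)" by simp
  finally have 1: "(2 * \<mu> / real CARD('d)) * ?b \<le> (2 * C / c) * (2 * \<mu> * ?s)" .
  have 2: "0 \<le> 2 * \<mu> * ?s" "0 \<le> (2 * C / c) * (lam * ?b)" using s0 \<mu> lam C_pos c_pos by simp_all
  have "z2 * ?b = lam * ?b + (2 * \<mu> / real CARD('d)) * ?b" by (simp add: z2_def algebra_simps)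
  also have "\<dots> \<le> (2 * \<mu> * ?s + lam * ?b) + (2 * C / c) * (2 * \<mu> * ?s) + (2 * C / c) * (lam * ?b)"
    using 1 2 by linarith
  also have "\<dots> = \<kappa> * a v v" by (simp add: \<kappa>_def elast_RQ_def algebra_simps)
  finally show ?thesis .
qed

lemma energy_le_H1:
  assumes v: "v \<in> Vh"
  shows "a v v \<le> C2 * z2 * (H1v_norm \<Omega> v)\<^sup>2"
proof -
  let ?s = "ip \<Omega> (strain \<Omega> v) (strain \<Omega> v)" and ?b = "ip \<Omega> (Pdiv v) (Pdiv v)"
  let ?n = "(H1v_norm \<Omega> v)\<^sup>2"
  have s0: "?s \<ge> 0" "?b \<ge> 0" by (simp_all add: ip_nonneg)
  have "?b \<le> ip \<Omega> (dvg \<Omega> v) (dvg \<Omega> v)" by (rule L2_proj_norm_le[OF feQ QL2 V_div[OF v]])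
  then have b: "?b \<le> C * ?n" and s: "2 * ?s \<le> C * ?n"
    using strain_div_le[OF v] s0 ip_nonneg[of \<Omega> "dvg \<Omega> v"] by linarith+
  have d: "real CARD('d) \<ge> 1" by (simp add: Suc_leI)
  have "a v v = \<mu> * (2 * ?s) + lam * ?b" by (simp add: elast_RQ_def)
  also have "\<dots> \<le> \<mu> * (C * ?n) + lam * (C * ?n)"
    using b s \<mu> lam by (intro add_mono mult_left_mono) auto
  also have "\<dots> = (\<mu> + lam) * (C * ?n)" by (simp add: algebra_simps)
  also have "\<dots> \<le> (real CARD('d) * z2) * (C * ?n)"
  proof (intro mult_right_mono)
    have "real CARD('d) * z2 = real CARD('d) * lam + 2 * \<mu>" by (simp add: z2_def field_simps)
    moreover have "1 * lam \<le> real CARD('d) * lam" using d lam by (intro mult_right_mono) auto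
    ultimately show "\<mu> + lam \<le> real CARD('d) * z2" using \<mu> by linarith
  qed (use C_pos in simp)
  finally show ?thesis by (simp add: C2_def mult_ac)
qed

lemma norm_components_nonneg:
  assumes "u \<in> Vh" "w \<in> Wh"
  shows "0 \<le> a u u" "0 \<le> inverse cp * ip \<Omega> p p" "0 \<le> \<tau> * m w w" "0 \<le> \<tau>\<^sup>2 * cp * ip \<Omega> (dvg \<Omega> w) (dvg \<Omega> w)"
  using semi_inner_space.nonneg[OF a_semi assms(1)] semi_inner_space.nonneg[OF m_semi W_L2[OF assms(2)]]
    cp_pos \<tau> by (simp_all add: ip_nonneg)

lemma norm_radicand_nonneg:
  assumes "u \<in> Vh" "w \<in> Wh"
  shows "0 \<le> a u u + inverse cp * ip \<Omega> p p + \<tau> * m w w + \<tau>\<^sup>2 * cp * ip \<Omega> (dvg \<Omega> w) (dvg \<Omega> w)"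
  using norm_components_nonneg(1,3,4)[OF assms] norm_components_nonneg(2)[OF assms, of p] by linarith

lemma norm_sq:
  assumes "u \<in> Vh" "w \<in> Wh"
  shows "(N (u, w, p))\<^sup>2 = a u u + inverse cp * ip \<Omega> p p + \<tau> * m w w + \<tau>\<^sup>2 * cp * ip \<Omega> (dvg \<Omega> w) (dvg \<Omega> w)"
  using norm_radicand_nonneg[OF assms, of p] unfolding cp_def by (simp add: nrm_squared)

lemma norm_nonneg: "x \<in> X \<Longrightarrow> 0 \<le> N x"
  by (cases x) (auto simp: nrm_squared intro: norm_radicand_nonneg[unfolded cp_def])

text \<open>Since \<open>p\<close> is discrete, only the projected divergence of \<open>v\<close> is seen, which is what the
reduced-quadrature energy controls; and \<open>\<alpha>\<^sup>2 / \<zeta>\<^sup>2 \<le> 1 / c\<^sub>p\<close>.\<close>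

lemma coupling_sq:
  assumes v: "v \<in> Vh" and p: "p \<in> Qh"
  shows "(\<alpha> * ip \<Omega> p (dvg \<Omega> v))\<^sup>2 \<le> \<kappa> * ((inverse cp * ip \<Omega> p p) * a v v)"
proof -
  let ?b = "ip \<Omega> (Pdiv v) (Pdiv v)"
  have "ip \<Omega> p (dvg \<Omega> v) = ip \<Omega> p (Pdiv v)" using ip_Pdiv[OF v p] by (simp add: ip_commute)
  then have "(\<alpha> * ip \<Omega> p (dvg \<Omega> v))\<^sup>2 \<le> \<alpha>\<^sup>2 * (ip \<Omega> p p * ?b)"
    using Q_Cauchy_Schwarz_sq[OF Q_L2[OF p] Q_L2[OF Pdiv_Q[OF v]]]
    by (simp add: power_mult_distrib mult_left_mono)
  also have "\<dots> = (\<alpha>\<^sup>2 / z2 * ip \<Omega> p p) * (z2 * ?b)" using z2_pos by simp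
  also have "\<dots> \<le> (inverse cp * ip \<Omega> p p) * (\<kappa> * a v v)"
  proof (rule mult_mono)
    show "\<alpha>\<^sup>2 / z2 * ip \<Omega> p p \<le> inverse cp * ip \<Omega> p p"
      unfolding cp_inverse using M by (intro mult_right_mono) (auto simp: ip_nonneg)
  qed (use Pdiv_le_energy[OF v] cp_pos z2_pos in \<open>simp_all add: ip_nonneg\<close>)
  finally show ?thesis by (simp add: mult_ac)
qed

lemma flux_coupling_sq:
  assumes w: "w \<in> Wh" and p: "p \<in> Qh"
  shows "(\<tau> * ip \<Omega> p (dvg \<Omega> w))\<^sup>2 \<le> (inverse cp * ip \<Omega> p p) * (\<tau>\<^sup>2 * cp * ip \<Omega> (dvg \<Omega> w) (dvg \<Omega> w))"
proof -
  have "(\<tau> * ip \<Omega> p (dvg \<Omega> w))\<^sup>2 \<le> \<tau>\<^sup>2 * (ip \<Omega> p p * ip \<Omega> (dvg \<Omega> w) (dvg \<Omega> w))"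
    using Q_Cauchy_Schwarz_sq[OF Q_L2[OF p] W_div[OF w]] by (simp add: power_mult_distrib mult_left_mono)
  also have "\<dots> = (inverse cp * ip \<Omega> p p) * (\<tau>\<^sup>2 * cp * ip \<Omega> (dvg \<Omega> w) (dvg \<Omega> w))"
    using cp_pos by (simp add: field_simps)
  finally show ?thesis .
qed

lemma biot_form_bounded:
  assumes "x \<in> X" "y \<in> X"
  shows "\<bar>\<B> x y\<bar> \<le> cont_const * (N x * N y)"
proof -
  obtain u w p where x: "x = (u, w, p)" "u \<in> Vh" "w \<in> Wh" "p \<in> Qh" using assms(1) by (cases x) auto
  obtain v r q where y: "y = (v, r, q)" "v \<in> Vh" "r \<in> Wh" "q \<in> Qh" using assms(2) by (cases y) auto
  note nx = norm_components_nonneg(1)[OF x(2,3)] norm_components_nonneg(2)[OF x(2,3), of p]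
    norm_components_nonneg(3,4)[OF x(2,3)] norm_nonneg[OF assms(1)]
  note ny = norm_components_nonneg(1)[OF y(2,3)] norm_components_nonneg(2)[OF y(2,3), of q]
    norm_components_nonneg(3,4)[OF y(2,3)] norm_nonneg[OF assms(2)]
  note sx = norm_sq[OF x(2,3), of p, folded x(1)]
  note sy = norm_sq[OF y(2,3), of q, folded y(1)]
  have le_x: "a u u \<le> (N x)\<^sup>2" "inverse cp * ip \<Omega> p p \<le> (N x)\<^sup>2" "\<tau> * m w w \<le> (N x)\<^sup>2"
      "\<tau>\<^sup>2 * cp * ip \<Omega> (dvg \<Omega> w) (dvg \<Omega> w) \<le> (N x)\<^sup>2"
    unfolding sx using nx(1-4) by linarith+
  have le_y: "a v v \<le> (N y)\<^sup>2" "inverse cp * ip \<Omega> q q \<le> (N y)\<^sup>2" "\<tau> * m r r \<le> (N y)\<^sup>2"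
      "\<tau>\<^sup>2 * cp * ip \<Omega> (dvg \<Omega> r) (dvg \<Omega> r) \<le> (N y)\<^sup>2"
    unfolding sy using ny(1-4) by linarith+
  have k0: "0 \<le> \<kappa>" using const_pos(1) by simp
  have t1: "\<bar>a u v\<bar> \<le> sqrt 1 * (N x * N y)"
    by (rule abs_le_from_square[OF _ nx(1) ny(1) le_x(1) le_y(1) _ nx(5) ny(5)])
       (use semi_inner_space.Cauchy_Schwarz_sq[OF a_semi x(2) y(2)] in auto)
  have t2: "\<bar>\<alpha> * ip \<Omega> p (dvg \<Omega> v)\<bar> \<le> sqrt \<kappa> * (N x * N y)"
    by (rule abs_le_from_square[OF coupling_sq[OF y(2) x(4)] nx(2) ny(1) le_x(2) le_y(1) k0 nx(5) ny(5)])
  have t3: "\<bar>\<tau> * m w r\<bar> \<le> sqrt 1 * (N x * N y)"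
  proof (rule abs_le_from_square[OF _ nx(3) ny(3) le_x(3) le_y(3) _ nx(5) ny(5)])
    show "(\<tau> * m w r)\<^sup>2 \<le> 1 * ((\<tau> * m w w) * (\<tau> * m r r))"
      using mult_left_mono[OF semi_inner_space.Cauchy_Schwarz_sq[OF m_semi W_L2[OF x(3)] W_L2[OF y(3)]], of "\<tau>\<^sup>2"]
      by (simp add: power2_eq_square mult_ac)
  qed simp
  have t4: "\<bar>\<tau> * ip \<Omega> p (dvg \<Omega> r)\<bar> \<le> sqrt 1 * (N x * N y)"
    by (rule abs_le_from_square[OF _ nx(2) ny(4) le_x(2) le_y(4) _ nx(5) ny(5)])
       (use flux_coupling_sq[OF y(3) x(4)] in auto)
  have t5: "\<bar>\<tau> * ip \<Omega> q (dvg \<Omega> w)\<bar> \<le> sqrt 1 * (N y * N x)"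
    by (rule abs_le_from_square[OF _ ny(2) nx(4) le_y(2) le_x(4) _ ny(5) nx(5)])
       (use flux_coupling_sq[OF x(3) y(4)] in auto)
  have t6: "\<bar>(1 / M) * ip \<Omega> p q\<bar> \<le> sqrt 1 * (N x * N y)"
  proof (rule abs_le_from_square[OF _ nx(2) ny(2) le_x(2) le_y(2) _ nx(5) ny(5)])
    have Mc: "1 / M \<le> inverse cp" unfolding cp_inverse using z2_pos by simp
    have MM: "(1 / M) * (1 / M) \<le> inverse cp * inverse cp"
      using Mc M cp_pos by (intro mult_mono) auto
    have "((1 / M) * ip \<Omega> p q)\<^sup>2 = ((1 / M) * (1 / M)) * (ip \<Omega> p q)\<^sup>2" by (simp add: power2_eq_square)
    also have "\<dots> \<le> (inverse cp * inverse cp) * (ip \<Omega> p p * ip \<Omega> q q)"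
      by (rule mult_mono[OF MM Q_Cauchy_Schwarz_sq[OF Q_L2[OF x(4)] Q_L2[OF y(4)]]])
         (use cp_pos in auto)
    finally show "((1 / M) * ip \<Omega> p q)\<^sup>2 \<le> 1 * ((inverse cp * ip \<Omega> p p) * (inverse cp * ip \<Omega> q q))"
      by (simp only: mult_1 mult_ac)
  qed simp
  have t7: "\<bar>\<alpha> * ip \<Omega> q (dvg \<Omega> u)\<bar> \<le> sqrt \<kappa> * (N y * N x)"
    by (rule abs_le_from_square[OF coupling_sq[OF x(2) y(4)] ny(2) nx(1) le_y(2) le_x(1) k0 ny(5) nx(5)])
  have "\<B> x y = a u v - \<alpha> * ip \<Omega> p (dvg \<Omega> v) + \<tau> * m w r - \<tau> * ip \<Omega> p (dvg \<Omega> r)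
      - \<tau> * ip \<Omega> q (dvg \<Omega> w) - (1 / M) * ip \<Omega> p q - \<alpha> * ip \<Omega> q (dvg \<Omega> u)"
    unfolding x(1) y(1) by (simp add: ip_commute[of \<Omega> q]) (simp add: ip_def mult.assoc)
  moreover have "cont_const * (N x * N y) = 5 * (N x * N y) + 2 * (sqrt \<kappa> * (N x * N y))"
    by (simp add: cont_const_def algebra_simps)
  moreover have "\<bar>s1 - s2 + s3 - s4 - s5 - s6 - s7\<bar> \<le> 5 * z + 2 * z'"
    if "\<bar>s1\<bar> \<le> z" "\<bar>s2\<bar> \<le> z'" "\<bar>s3\<bar> \<le> z" "\<bar>s4\<bar> \<le> z" "\<bar>s5\<bar> \<le> z" "\<bar>s6\<bar> \<le> z" "\<bar>s7\<bar> \<le> z'"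
    for s1 s2 s3 s4 s5 s6 s7 z z' :: real
    using that unfolding abs_le_iff by (intro conjI; linarith)
  ultimately show ?thesis
    using t1 t2 t3 t4 t5 t6 t7 unfolding real_sqrt_one mult_1 mult.commute[of "N y" "N x"] by metis
qed

text \<open>For \<open>y = (u, w, p)\<close> the test function is \<open>x = (u + s v, w, - p - t div w)\<close>. The choice \<open>(u, w, -p)\<close>
cancels the skew terms and leaves \<open>\<parallel>u\<parallel>\<^sub>A\<^sup>2 + \<tau> \<parallel>w\<parallel>\<^sub>M\<^sup>2 + \<parallel>p\<parallel>\<^sup>2 / M\<close>. Two contributions to the norm are still
missing. With \<open>v\<close> from the Stokes inf-sup condition and \<open>s\<close> a small multiple of \<open>- \<alpha> / \<zeta>\<^sup>2\<close>, the term
\<open>- \<alpha> s (div v, p)\<close> supplies the share \<open>\<alpha>\<^sup>2 / \<zeta>\<^sup>2 \<parallel>p\<parallel>\<^sup>2\<close> of \<open>\<parallel>p\<parallel>\<^sup>2 / c\<^sub>p\<close>; with \<open>t\<close> a small multiple of \<open>\<tau> c\<^sub>p\<close>,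
\<open>\<tau> t \<parallel>div w\<parallel>\<^sup>2\<close> supplies the divergence part. This last test pressure is admissible because \<open>div w\<close>
lies in \<open>Q\<^sub>h\<close>.\<close>

lemma biot_form_inf_sup:
  assumes "y \<in> X"
  shows "\<exists>x\<in>X. low_const * (N y)\<^sup>2 \<le> \<B> x y \<and> (N x)\<^sup>2 \<le> up_const * (N y)\<^sup>2"
proof -
  obtain u w p where y: "y = (u, w, p)" "u \<in> Vh" "w \<in> Wh" "p \<in> Qh" using assms by (cases y) auto
  obtain v where v: "v \<in> Vh" "\<beta> * ip \<Omega> p p \<le> ip \<Omega> (dvg \<Omega> v) p" "(H1v_norm \<Omega> v)\<^sup>2 \<le> ip \<Omega> p p"
    using inf_sup[OF y(4)] by blast
  \<comment> \<open>The representative \<open>d\<close> of \<open>div w\<close> in \<open>Qh\<close>; the two may differ on a null set.\<close>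
  obtain d where d: "d \<in> Qh" "AE x in lebesgue_on \<Omega>. dvg \<Omega> w x = d x" using div_W[OF y(3)] by blast
  have dw: "ip \<Omega> (dvg \<Omega> w) f = ip \<Omega> d f" "ip \<Omega> f (dvg \<Omega> w) = ip \<Omega> f d" if "f \<in> L2 \<Omega>" for f
    using ip_cong[OF d(2) W_div[OF y(3)] Q_L2[OF d(1)] that] by (simp_all add: ip_commute)
  have DD: "ip \<Omega> (dvg \<Omega> w) (dvg \<Omega> w) = ip \<Omega> d d"
    using dw Q_L2[OF d(1)] W_div[OF y(3)] by simp
  define s where "s = - \<theta> * \<alpha> / z2"
  define t where "t = \<eta> * \<tau> * cp"
  define k where "k = \<alpha>\<^sup>2 / z2"
  let ?pp = "ip \<Omega> p p" and ?dd = "ip \<Omega> d d"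
  define D where "D = \<tau>\<^sup>2 * cp * ?dd"
  define u' where "u' = (\<lambda>x. u x + s *\<^sub>R v x)"
  define p1 where "p1 = (\<lambda>x. (-1) *\<^sub>R p x)"
  define p' where "p' = (\<lambda>x. p1 x + (- t) *\<^sub>R d x)"
  have u': "u' \<in> Vh" unfolding u'_def by (rule fe_space_comb[OF feV y(2) v(1)])
  have p1: "p1 \<in> Qh" unfolding p1_def using feQ y(4) unfolding fe_space_def by blast
  have p': "p' \<in> Qh" unfolding p'_def by (rule fe_space_comb[OF feQ p1 d(1)])
  have ipp1: "ip \<Omega> p1 f = - ip \<Omega> p f" "ip \<Omega> f p1 = - ip \<Omega> f p" for f
    by (simp_all add: p1_def ip_def)
  have ipp': "ip \<Omega> p' f = - ip \<Omega> p f - t * ip \<Omega> d f" if "f \<in> L2 \<Omega>" for f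
    unfolding p'_def using ip_comb[OF Q_L2[OF p1] Q_L2[OF d(1)] that, of "- t"] by (simp add: ipp1)
  have k_pos: "k > 0" using \<alpha> z2_pos by (simp add: k_def)
  have cpk: "inverse cp = k + 1 / M" by (simp add: cp_inverse k_def)
  have D0: "D \<ge> 0" "?pp \<ge> 0" "?dd \<ge> 0" using cp_pos by (simp_all add: D_def ip_nonneg)
  note A0 = semi_inner_space.nonneg[OF a_semi y(2)]
  note mm0 = norm_components_nonneg(3)[OF y(2,3)]

  have form: "\<B> (u', w, p') y = a u u + s * a v u + t * (\<alpha> * ip \<Omega> d (dvg \<Omega> u)) + \<tau> * m w w
      + \<tau> * t * ?dd + (1 / M) * ?pp + t / M * ip \<Omega> d p - \<alpha> * s * ip \<Omega> (dvg \<Omega> v) p"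
  proof -
    have e1: "a u' u = a u u + s * a v u"
      unfolding u'_def by (rule semi_inner_space.comb_left[OF a_semi y(2) v(1) y(2)])
    have e2: "ip \<Omega> (\<lambda>x. \<alpha> * p' x) (dvg \<Omega> u) = \<alpha> * (- ip \<Omega> p (dvg \<Omega> u) - t * ip \<Omega> d (dvg \<Omega> u))"
      using ipp'[OF V_div[OF y(2)]] by (simp add: ip_def mult.assoc)
    have e3: "ip \<Omega> p' (dvg \<Omega> w) = - ip \<Omega> p d - t * ?dd"
      using ipp'[OF W_div[OF y(3)]] dw Q_L2[OF d(1)] Q_L2[OF y(4)] by simp
    have e4: "ip \<Omega> (dvg \<Omega> w) p = ip \<Omega> p d" using dw Q_L2[OF y(4)] by (simp add: ip_commute)
    have e5: "ip \<Omega> (\<lambda>x. (1 / M) * p' x) p = (1 / M) * (- ?pp - t * ip \<Omega> d p)"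
      using ipp'[OF Q_L2[OF y(4)]] by (simp add: ip_def)
    have e6: "ip \<Omega> (\<lambda>x. \<alpha> * dvg \<Omega> u' x) p = \<alpha> * (ip \<Omega> p (dvg \<Omega> u) + s * ip \<Omega> (dvg \<Omega> v) p)"
    proof -
      have "ip \<Omega> (\<lambda>x. \<alpha> * dvg \<Omega> u' x) p = \<alpha> * ip \<Omega> (dvg \<Omega> u') p" by (simp add: ip_def mult.assoc)
      then show ?thesis
        using ip_dvg_comb[OF y(2) v(1) y(4), of s] by (simp add: u'_def ip_commute)
    qed
    show ?thesis
      unfolding y(1) biot_form.simps e1 e2 e3 e4 e5 e6 by (simp add: algebra_simps)
  qed

  \<comment> \<open>The three mixed terms are absorbed by weighted arithmetic-geometric mean estimates.\<close>
  have sAv: "s\<^sup>2 * a v v \<le> \<theta>\<^sup>2 * C2 * (k * ?pp)"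
  proof -
    have "a v v \<le> C2 * z2 * ?pp"
      using energy_le_H1[OF v(1)] mult_left_mono[OF v(3), of "C2 * z2"]
        mult_pos_pos[OF const_pos(2) z2_pos] by linarith
    then have "s\<^sup>2 * a v v \<le> s\<^sup>2 * (C2 * z2 * ?pp)" by (intro mult_left_mono) auto
    also have "\<dots> = \<theta>\<^sup>2 * C2 * (k * ?pp)"
      using z2_pos by (simp add: s_def k_def power2_eq_square field_simps)
    finally show ?thesis .
  qed
  have \<theta>C: "\<theta>\<^sup>2 * C2 = \<theta> * \<beta> / 2" using const_pos by (simp add: \<theta>_def power2_eq_square field_simps)
  have \<kappa>\<eta>: "\<kappa> * \<eta>\<^sup>2 = \<eta> / 4" and \<eta>4: "\<eta> \<le> 1 / 4"
    using const_pos(1) by (simp_all add: \<eta>_def power2_eq_square field_simps)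

  have T1: "\<bar>s * a v u\<bar> \<le> \<theta> * \<beta> / 2 * (k * ?pp) + a u u / 4"
  proof -
    have "(s * a v u)\<^sup>2 \<le> s\<^sup>2 * (a v v * a u u)"
      using semi_inner_space.Cauchy_Schwarz_sq[OF a_semi v(1) y(2)]
      by (simp add: power_mult_distrib mult_left_mono)
    also have "\<dots> \<le> (\<theta>\<^sup>2 * C2 * (k * ?pp)) * a u u"
      using mult_right_mono[OF sAv A0] by (simp add: mult.assoc)
    also have "\<dots> = (\<theta> * \<beta> * (k * ?pp)) * (a u u / 2)" unfolding \<theta>C by simp
    finally have "\<bar>s * a v u\<bar> \<le> (\<theta> * \<beta> * (k * ?pp) + a u u / 2) / 2"
      by (rule abs_le_mean) (use const_pos \<beta>_pos k_pos D0 A0 in auto)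
    then show ?thesis by (simp add: field_simps)
  qed
  have T2: "\<bar>t * (\<alpha> * ip \<Omega> d (dvg \<Omega> u))\<bar> \<le> \<eta> / 4 * D + a u u / 4"
  proof -
    have "(t * (\<alpha> * ip \<Omega> d (dvg \<Omega> u)))\<^sup>2 \<le> t\<^sup>2 * (\<kappa> * ((inverse cp * ?dd) * a u u))"
      using coupling_sq[OF y(2) d(1)] by (subst power_mult_distrib) (rule mult_left_mono, auto)
    also have "\<dots> = (2 * (\<kappa> * \<eta>\<^sup>2) * D) * (a u u / 2)"
      using cp_pos by (simp add: t_def D_def power2_eq_square field_simps)
    also have "\<dots> = (\<eta> / 2 * D) * (a u u / 2)" unfolding \<kappa>\<eta> by simp
    finally have "\<bar>t * (\<alpha> * ip \<Omega> d (dvg \<Omega> u))\<bar> \<le> (\<eta> / 2 * D + a u u / 2) / 2"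
      by (rule abs_le_mean) (use const_pos D0 A0 in auto)
    then show ?thesis by (simp add: field_simps)
  qed
  have T3: "\<bar>t / M * ip \<Omega> d p\<bar> \<le> \<eta> / 4 * D + \<eta> * (?pp / M)"
  proof -
    have cM: "cp / M \<le> 1"
    proof -
      have "1 / M \<le> inverse cp" using k_pos by (simp add: cpk)
      then have "cp * (1 / M) \<le> cp * inverse cp" using cp_pos by (intro mult_left_mono) auto
      then show ?thesis using cp_pos by simp
    qed
    have "(t / M * ip \<Omega> d p)\<^sup>2 \<le> (t / M)\<^sup>2 * (?dd * ?pp)"
      using Q_Cauchy_Schwarz_sq[OF Q_L2[OF d(1)] Q_L2[OF y(4)]]
      by (subst power_mult_distrib) (rule mult_left_mono, auto)
    also have "\<dots> = (cp / M) * (\<eta>\<^sup>2 * D * (?pp / M))"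
      by (simp add: t_def D_def power2_eq_square)
    also have "\<dots> \<le> 1 * (\<eta>\<^sup>2 * D * (?pp / M))"
      using cM D0 M by (intro mult_right_mono) auto
    also have "\<dots> = (\<eta> / 2 * D) * (2 * \<eta> * (?pp / M))" by (simp add: power2_eq_square)
    finally have "\<bar>t / M * ip \<Omega> d p\<bar> \<le> (\<eta> / 2 * D + 2 * \<eta> * (?pp / M)) / 2"
      by (rule abs_le_mean) (use const_pos D0 M in auto)
    then show ?thesis by (simp add: field_simps)
  qed
  have T4: "- (\<alpha> * s * ip \<Omega> (dvg \<Omega> v) p) \<ge> \<theta> * \<beta> * (k * ?pp)"
  proof -
    have "\<theta> * k * (\<beta> * ?pp) \<le> \<theta> * k * ip \<Omega> (dvg \<Omega> v) p"
      using v(2) const_pos k_pos by (intro mult_left_mono) auto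
    moreover have "- (\<alpha> * s * ip \<Omega> (dvg \<Omega> v) p) = \<theta> * k * ip \<Omega> (dvg \<Omega> v) p"
      by (simp add: s_def k_def power2_eq_square)
    ultimately show ?thesis by (simp add: mult_ac)
  qed
  have T5: "\<tau> * t * ?dd = \<eta> * D" by (simp add: t_def D_def power2_eq_square)
  have ny: "(N y)\<^sup>2 = a u u + (k * ?pp + ?pp / M) + \<tau> * m w w + D"
    unfolding y(1) norm_sq[OF y(2,3)] cpk D_def DD by (simp add: algebra_simps)

  have low: "low_const * (N y)\<^sup>2 \<le> \<B> (u', w, p') y"
  proof -
    have kpp: "k * ?pp \<ge> 0" "?pp / M \<ge> 0" using k_pos D0 M by auto
    have "low_const \<le> 1 / 2" "low_const \<le> \<theta> * \<beta> / 2" "low_const \<le> \<eta> / 2"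
      by (auto simp: low_const_def)
    from lower_bound_arith[OF T1 T2 T3 T4 \<eta>4 A0 kpp mm0 D0(1) this]
    show ?thesis unfolding form T5 ny by simp
  qed

  have up: "(N (u', w, p'))\<^sup>2 \<le> up_const * (N y)\<^sup>2"
  proof -
    have kpp: "k * ?pp \<ge> 0" "?pp / M \<ge> 0" using k_pos D0 M by auto
    have U: "a u' u' \<le> 2 * a u u + \<theta> * \<beta> * (k * ?pp)"
      using semi_inner_space.comb_self_le[OF a_semi y(2) v(1), of s] sAv unfolding u'_def \<theta>C by simp
    have P: "inverse cp * ip \<Omega> p' p' \<le> 2 * (k * ?pp + ?pp / M) + 2 * \<eta>\<^sup>2 * D"
    proof -
      have "ip \<Omega> p' p' \<le> 2 * ip \<Omega> p1 p1 + 2 * ((- t)\<^sup>2 * ?dd)"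
        unfolding p'_def by (rule semi_inner_space.comb_self_le[OF semi_inner_ip Q_L2[OF p1] Q_L2[OF d(1)]])
      then have "inverse cp * ip \<Omega> p' p' \<le> inverse cp * (2 * ?pp + 2 * (t\<^sup>2 * ?dd))"
        using cp_pos by (intro mult_left_mono) (auto simp: ipp1)
      also have "\<dots> = 2 * (inverse cp * ?pp) + 2 * \<eta>\<^sup>2 * D"
        using cp_pos by (simp add: t_def D_def power2_eq_square field_simps)
      also have "inverse cp * ?pp = k * ?pp + ?pp / M" by (simp add: cpk algebra_simps)
      finally show ?thesis .
    qed
    have nx: "(N (u', w, p'))\<^sup>2 = a u' u' + inverse cp * ip \<Omega> p' p' + \<tau> * m w w + D"
      unfolding norm_sq[OF u' y(3)] D_def DD by simp
    have tb: "\<theta> * \<beta> * (k * ?pp) \<le> \<theta> * \<beta> * (N y)\<^sup>2"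
      unfolding ny using const_pos \<beta>_pos A0 kpp mm0 D0 by (intro mult_left_mono) auto
    have eb: "2 * \<eta>\<^sup>2 * D \<le> 2 * \<eta>\<^sup>2 * (N y)\<^sup>2"
      unfolding ny using A0 kpp mm0 D0 by (intro mult_left_mono) auto
    have "up_const * (N y)\<^sup>2 = 3 * (N y)\<^sup>2 + \<theta> * \<beta> * (N y)\<^sup>2 + 2 * \<eta>\<^sup>2 * (N y)\<^sup>2"
      by (simp add: up_const_def algebra_simps)
    moreover have "2 * a u u + 2 * (k * ?pp + ?pp / M) + \<tau> * m w w + D \<le> 3 * (N y)\<^sup>2"
      unfolding ny by (rule upper_bound_arith[OF A0 add_nonneg_nonneg[OF kpp] mm0 D0(1)])
    ultimately show ?thesis unfolding nx using U P tb eb by linarith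
  qed
  show ?thesis using low up u' y(3) p' by (intro bexI[of _ "(u', w, p')"]) auto
qed

text \<open>A vanishing energy forces a vanishing strain as \<open>\<mu> > 0\<close>, and then \<open>u = 0\<close> by Korn's inequality.\<close>

lemma norm_pos:
  assumes "y \<in> X" "\<not> state_zero \<Omega> y"
  shows "N y > 0"
proof (rule ccontr)
  obtain u w p where y: "y = (u, w, p)" "u \<in> Vh" "w \<in> Wh" "p \<in> Qh" using assms by (cases y) auto
  assume "\<not> N y > 0"
  then have "(N y)\<^sup>2 = 0" using norm_nonneg[OF assms(1)] by simp
  then have z: "a u u = 0" "inverse cp * ip \<Omega> p p = 0" "\<tau> * m w w = 0"
    using norm_components_nonneg(1,3,4)[OF y(2,3)] norm_components_nonneg(2)[OF y(2,3), of p]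
      norm_sq[OF y(2,3), of p] unfolding y(1) by linarith+
  have "ip \<Omega> (strain \<Omega> u) (strain \<Omega> u) = 0"
  proof -
    have "2 * \<mu> * ip \<Omega> (strain \<Omega> u) (strain \<Omega> u) \<ge> 0" "lam * ip \<Omega> (Pdiv u) (Pdiv u) \<ge> 0"
      using \<mu> lam by (simp_all add: ip_nonneg)
    then have "2 * \<mu> * ip \<Omega> (strain \<Omega> u) (strain \<Omega> u) = 0" using z(1) unfolding elast_RQ_def by linarith
    then show ?thesis using \<mu> by simp
  qed
  then have "(H1v_norm \<Omega> u)\<^sup>2 \<le> 0" using Korn[OF y(2)] c_pos by (simp add: mult_le_0_iff)
  then have "ip \<Omega> u u + ip \<Omega> (jac \<Omega> u) (jac \<Omega> u) \<le> 0"
    by (simp add: H1v_norm_def nrm_squared ip_nonneg)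
  then have "ip \<Omega> u u = 0" using ip_nonneg[of \<Omega> u] ip_nonneg[of \<Omega> "jac \<Omega> u"] by linarith
  then have "ae_zero \<Omega> u" using V_L2[OF y(2)] by (simp add: ae_zero_iff)
  moreover have "ae_zero \<Omega> p" using z(2) cp_pos Q_L2[OF y(4)] by (simp add: ae_zero_iff)
  moreover have "ae_zero \<Omega> w" using z(3) \<tau> Darcy_semi_inner(2)[OF perm \<mu>f op W_L2[OF y(3)]] by simp
  ultimately show False using assms(2) y(1) by simp
qed

lemma norm_state_zero:
  assumes "y \<in> X" "state_zero \<Omega> y"
  shows "N y = 0"
proof -
  obtain u w p where y: "y = (u, w, p)" "u \<in> Vh" "w \<in> Wh" "p \<in> Qh" using assms by (cases y) auto
  have z: "ae_zero \<Omega> u" "ae_zero \<Omega> w" "ae_zero \<Omega> p" using assms(2) y(1) by auto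
  have "ip \<Omega> (strain \<Omega> u) (strain \<Omega> u) = 0"
    using strain_ae_zero[OF _ z(1)] strain_L2 y(2) VH1 ae_zero_iff by blast
  moreover have "ip \<Omega> (Pdiv u) (Pdiv u) = 0"
  proof -
    have "ip \<Omega> (dvg \<Omega> u) (dvg \<Omega> u) = 0"
      using dvg_ae_zero[OF V_L2[OF y(2)] z(1)] V_div[OF y(2)] ae_zero_iff by blast
    then show ?thesis
      using L2_proj_norm_le[OF feQ QL2 V_div[OF y(2)]] ip_nonneg[of \<Omega> "Pdiv u"] by linarith
  qed
  ultimately have "a u u = 0" by (simp add: elast_RQ_def)
  moreover have "ip \<Omega> p p = 0" using z(3) Q_L2[OF y(4)] ae_zero_iff by blast
  moreover have "ip \<Omega> (dvg \<Omega> w) (dvg \<Omega> w) = 0"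
    using dvg_ae_zero[OF W_L2[OF y(3)] z(2)] W_div[OF y(3)] ae_zero_iff by blast
  moreover have "m w w = 0"
    unfolding darcy_def ip_def using z(2)
    by (intro integral_eq_zero_AE) (auto simp: ae_zero_def elim: eventually_mono)
  ultimately show ?thesis by (simp add: y(1) nrm_squared)
qed

lemma quotient_le:
  assumes "x \<in> nonzero_states \<Omega> Vh Wh Qh" "y \<in> nonzero_states \<Omega> Vh Wh Qh"
  shows "biot_quotient \<Omega> Qh lam \<mu> \<alpha> M \<mu>f K \<tau> x y \<le> cont_const"
proof -
  have x: "x \<in> X" "N x > 0" and y: "y \<in> X" "N y > 0"
    using assms norm_pos by (auto simp: nonzero_states_def)
  have "\<B> x y \<le> cont_const * (N x * N y)" using biot_form_bounded[OF x(1) y(1)] by linarith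
  then show ?thesis using x y by (simp add: biot_quotient_def pos_divide_le_eq)
qed

text \<open>The test function is nonzero: the form takes a positive value on it, but by continuity it would
take the value \<open>0\<close> if the norm of the test function vanished.\<close>

lemma quotient_ge:
  assumes "y \<in> nonzero_states \<Omega> Vh Wh Qh"
  shows "\<exists>x\<in>nonzero_states \<Omega> Vh Wh Qh.
    low_const / sqrt up_const \<le> biot_quotient \<Omega> Qh lam \<mu> \<alpha> M \<mu>f K \<tau> x y"
proof -
  have y: "y \<in> X" "N y > 0"
    using assms norm_pos by (auto simp: nonzero_states_def)
  obtain x where x: "x \<in> X" "low_const * (N y)\<^sup>2 \<le> \<B> x y" "(N x)\<^sup>2 \<le> up_const * (N y)\<^sup>2"
    using biot_form_inf_sup[OF y(1)] by blast
  have low: "0 < low_const * (N y)\<^sup>2" using const_pos y by simp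
  have "N x \<noteq> 0"
  proof
    assume "N x = 0"
    then show False using biot_form_bounded[OF x(1) y(1)] x(2) low by simp
  qed
  then have nx: "N x > 0" using norm_nonneg[OF x(1)] by simp
  have nz: "x \<in> nonzero_states \<Omega> Vh Wh Qh"
    using x(1) norm_state_zero[OF x(1)] nx by (auto simp: nonzero_states_def)
  have nxy: "N x \<le> sqrt up_const * N y"
    using real_sqrt_le_mono[OF x(3)] nx y(2) by (simp add: real_sqrt_mult)
  have "low_const / sqrt up_const * (N x * N y) \<le> low_const / sqrt up_const * (sqrt up_const * N y * N y)"
    using nxy y const_pos by (intro mult_left_mono mult_right_mono) auto
  also have "\<dots> = low_const * (N y)\<^sup>2" using const_pos(7) by (simp add: power2_eq_square)
  also have "\<dots> \<le> \<B> x y" by (rule x(2))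
  finally have "low_const / sqrt up_const \<le> \<B> x y / (N x * N y)"
    using nx y by (simp add: pos_le_divide_eq)
  with nz show ?thesis by (auto simp: biot_quotient_def)
qed

end

section \<open>Uniform stability of the discrete Biot system\<close>

text \<open>The supremum need not be attained, so the constant is halved, and a function whose quotient
reaches half of the lower bound is rescaled to have norm \<open>\<parallel>p\<parallel>\<close>. For \<open>p = 0\<close> the supremum being greater than \<open>-\<infinity>\<close> still
provides a nonzero \<open>v\<close>, which is rescaled to zero.\<close>

lemma (in bounded_open) stokes_witness:
  assumes V: "fe_space \<Omega> V" "V \<subseteq> H1v \<Omega>" and p: "p \<in> L2 \<Omega>" and \<gamma>: "\<gamma> > 0"
    and sup: "(SUP v\<in>{v\<in>V. \<not> ae_zero \<Omega> v}. ereal (ip \<Omega> (dvg \<Omega> v) p / H1v_norm \<Omega> v)) \<ge> ereal (\<gamma> * nrm \<Omega> p)"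
  shows "\<exists>v\<in>V. \<gamma> / 2 * ip \<Omega> p p \<le> ip \<Omega> (dvg \<Omega> v) p \<and> (H1v_norm \<Omega> v)\<^sup>2 \<le> ip \<Omega> p p"
proof -
  have p0: "nrm \<Omega> p \<ge> 0" by (simp add: nrm_def ip_nonneg)
  obtain v where v: "v \<in> V" "\<not> ae_zero \<Omega> v"
    and q: "nrm \<Omega> p > 0 \<Longrightarrow> \<gamma> / 2 * nrm \<Omega> p \<le> ip \<Omega> (dvg \<Omega> v) p / H1v_norm \<Omega> v"
  proof (cases "nrm \<Omega> p > 0")
    case True
    then have "ereal (\<gamma> / 2 * nrm \<Omega> p) < ereal (\<gamma> * nrm \<Omega> p)" using \<gamma> by simp
    also note sup
    finally show ?thesis using that unfolding less_SUP_iff by (auto intro: less_imp_le)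
  next
    case False
    have "- \<infinity> < ereal (\<gamma> * nrm \<Omega> p)" by simp
    also note sup
    finally show ?thesis using that False unfolding less_SUP_iff by auto
  qed
  let ?H = "H1v_norm \<Omega> v" and ?b = "\<lambda>u v. 1 * ip \<Omega> u v + 1 * ip \<Omega> (jac \<Omega> u) (jac \<Omega> v)"
  have vH: "v \<in> H1v \<Omega>" using v V by blast
  have L2V: "V \<subseteq> L2 \<Omega>" using V H1v_L2 by blast
  have b: "semi_inner_space V ?b"
  proof (rule semi_inner_add[OF semi_inner_subset[OF semi_inner_ip L2V] semi_inner_pullback])
    show "jac \<Omega> f \<in> L2 \<Omega>" if "f \<in> V" for f using that V jac_L2 by blast
    show "AE x in lebesgue_on \<Omega>. jac \<Omega> (\<lambda>x. f x + c *\<^sub>R g x) x = jac \<Omega> f x + c *\<^sub>R jac \<Omega> g x"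
      if "f \<in> V" "g \<in> V" for f g c using that V jac_comb by blast
  qed (use fe_space_comb[OF V(1)] in auto)
  have H2: "(H1v_norm \<Omega> u)\<^sup>2 = ?b u u" for u
    by (simp add: H1v_norm_def nrm_squared ip_nonneg)
  have "ip \<Omega> v v \<noteq> 0" using v(2) H1v_L2[OF vH] by (simp add: ae_zero_iff)
  then have "ip \<Omega> v v > 0" using ip_nonneg[of \<Omega> v] by simp
  then have "?b v v > 0" using ip_nonneg[of \<Omega> "jac \<Omega> v"] by simp
  then have H: "?H > 0"
    using H2[of v] by (simp add: H1v_norm_def nrm_squared ip_nonneg)
  define c where "c = nrm \<Omega> p / ?H"
  \<comment> \<open>This is \<open>c v\<close>, in the form to which the rules for \<open>f + c g\<close> apply.\<close>
  define v' where "v' = (\<lambda>x. v x + (c - 1) *\<^sub>R v x)"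
  have v': "v' \<in> V" unfolding v'_def by (rule fe_space_comb[OF V(1) v(1) v(1)])
  have "(H1v_norm \<Omega> v')\<^sup>2 = ?b v v + 2 * (c - 1) * ?b v v + (c - 1)\<^sup>2 * ?b v v"
    unfolding H2 v'_def by (rule semi_inner_space.comb_self[OF b v(1) v(1)])
  also have "\<dots> = c\<^sup>2 * ?H\<^sup>2" unfolding H2 by (simp add: power2_eq_square algebra_simps)
  also have "\<dots> = ip \<Omega> p p" using H by (simp add: c_def power_divide nrm_squared)
  finally have 1: "(H1v_norm \<Omega> v')\<^sup>2 \<le> ip \<Omega> p p" by simp
  have dv: "dvg \<Omega> v \<in> L2 \<Omega>" using vH H1v_Hdiv dvg_props by blast
  have "ip \<Omega> (dvg \<Omega> v') p = ip \<Omega> (\<lambda>x. dvg \<Omega> v x + (c - 1) *\<^sub>R dvg \<Omega> v x) p"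
    unfolding v'_def
    by (rule ip_cong[OF dvg_comb[OF H1v_Hdiv[OF vH] H1v_Hdiv[OF vH]] _ L2_comb[OF dv dv] p])
       (use v' V(2) H1v_Hdiv dvg_props v'_def in blast)
  also have "\<dots> = c * ip \<Omega> (dvg \<Omega> v) p"
    using ip_comb[OF dv dv p, of "c - 1"] by (simp add: algebra_simps)
  finally have e: "ip \<Omega> (dvg \<Omega> v') p = c * ip \<Omega> (dvg \<Omega> v) p" .
  have "\<gamma> / 2 * ip \<Omega> p p \<le> ip \<Omega> (dvg \<Omega> v') p"
  proof (cases "nrm \<Omega> p > 0")
    case True
    have "\<gamma> / 2 * ip \<Omega> p p = nrm \<Omega> p * (\<gamma> / 2 * nrm \<Omega> p)"
      unfolding nrm_squared[symmetric] by (simp add: power2_eq_square)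
    also have "\<dots> \<le> nrm \<Omega> p * (ip \<Omega> (dvg \<Omega> v) p / ?H)"
      using q[OF True] p0 by (intro mult_left_mono)
    finally show ?thesis by (simp add: e c_def)
  next
    case False
    then have "nrm \<Omega> p = 0" using p0 by simp
    then show ?thesis using nrm_squared[of \<Omega> p] by (simp add: e c_def)
  qed
  with 1 v' show ?thesis by blast
qed

theorem theorem2p2:
  fixes \<Omega> \<Gamma>t \<Gamma>c :: "(real^'d) set"
    and H :: "real set"
    and V W :: "real \<Rightarrow> (real^'d \<Rightarrow> real^'d) set"
    and Q :: "real \<Rightarrow> (real^'d \<Rightarrow> real) set"
  assumes "CARD('d) \<in> {2, 3}"
    and "poro_domain \<Omega> \<Gamma>t \<Gamma>c"
    and "fe_family \<Omega> \<Gamma>c H V W Q"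
    and "stokes_biot_stable \<Omega> H V W Q"
  shows "\<exists>\<sigma>>0. \<exists>\<gamma>>0. \<forall>lam \<mu> \<alpha> M \<mu>f K \<tau> h.
    lam \<ge> 0 \<longrightarrow> \<mu> > 0 \<longrightarrow> \<alpha> > 0 \<longrightarrow> M > 0 \<longrightarrow> \<mu>f > 0 \<longrightarrow> permeability \<Omega> K \<longrightarrow> \<tau> > 0 \<longrightarrow> h \<in> H \<longrightarrow>
      (SUP x \<in> nonzero_states \<Omega> (V h) (W h) (Q h). SUP y \<in> nonzero_states \<Omega> (V h) (W h) (Q h).
         ereal (biot_quotient \<Omega> (Q h) lam \<mu> \<alpha> M \<mu>f K \<tau> x y)) \<le> ereal \<sigma> \<and>
      (INF y \<in> nonzero_states \<Omega> (V h) (W h) (Q h). SUP x \<in> nonzero_states \<Omega> (V h) (W h) (Q h).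
         ereal (biot_quotient \<Omega> (Q h) lam \<mu> \<alpha> M \<mu>f K \<tau> x y)) \<ge> ereal \<gamma>"
proof -
  interpret bounded_open \<Omega>
    using assms(2) by unfold_locales (auto simp: poro_domain_def)
  obtain C where C: "C > 0"
    "\<And>h u v. h \<in> H \<Longrightarrow> u \<in> V h \<Longrightarrow> v \<in> V h \<Longrightarrow> elast \<Omega> 1 1 u v \<le> C * H1v_norm \<Omega> u * H1v_norm \<Omega> v"
    using assms(4) unfolding stokes_biot_stable_def by (metis zero_le_one zero_less_one)
  obtain c where c: "c > 0"
    "\<And>h u. h \<in> H \<Longrightarrow> u \<in> V h \<Longrightarrow> elast \<Omega> 0 1 u u \<ge> c * (H1v_norm \<Omega> u)\<^sup>2"
    using assms(4) unfolding stokes_biot_stable_def by (metis order_refl zero_less_one)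
  obtain \<gamma> where \<gamma>: "\<gamma> > 0"
    "\<And>h p. h \<in> H \<Longrightarrow> p \<in> Q h \<Longrightarrow>
       (SUP v\<in>{v\<in>V h. \<not> ae_zero \<Omega> v}. ereal (ip \<Omega> (dvg \<Omega> v) p / H1v_norm \<Omega> v)) \<ge> ereal (\<gamma> * nrm \<Omega> p)"
    using assms(4) unfolding stokes_biot_stable_def stokes_stable_def by blast
  have disc: "biot_discretization \<Omega> (V h) (W h) (Q h) C c (\<gamma> / 2)" if h: "h \<in> H" for h
  proof
    have fe: "fe_space \<Omega> (V h) \<and> V h \<subseteq> V_space \<Omega> \<Gamma>c \<and> fe_space \<Omega> (W h) \<and> W h \<subseteq> W_space \<Omega> \<Gamma>c \<and>
        fe_space \<Omega> (Q h) \<and> Q h \<subseteq> Q_space \<Omega>"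
      using assms(3) h by (simp add: fe_family_def)
    then show V: "fe_space \<Omega> (V h)" "V h \<subseteq> H1v \<Omega>" and "W h \<subseteq> Hdiv \<Omega>"
      and "fe_space \<Omega> (Q h)" and Q: "Q h \<subseteq> L2 \<Omega>"
      by (auto simp: V_space_def W_space_def Q_space_def)
    show "\<exists>q\<in>Q h. AE x in lebesgue_on \<Omega>. dvg \<Omega> w x = q x" if "w \<in> W h" for w
      using assms(4) h that by (simp add: stokes_biot_stable_def poisson_stable_def)
    show "C > 0" "c > 0" "\<gamma> / 2 > 0" using C c \<gamma> by simp_all
    show "2 * ip \<Omega> (strain \<Omega> v) (strain \<Omega> v) + ip \<Omega> (dvg \<Omega> v) (dvg \<Omega> v) \<le> C * (H1v_norm \<Omega> v)\<^sup>2"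
      if "v \<in> V h" for v using C(2)[OF h that that] by (simp add: elast_def power2_eq_square mult.assoc)
    show "c * (H1v_norm \<Omega> v)\<^sup>2 \<le> 2 * ip \<Omega> (strain \<Omega> v) (strain \<Omega> v)" if "v \<in> V h" for v
      using c(2)[OF h that] by (simp add: elast_def)
    show "\<exists>v\<in>V h. \<gamma> / 2 * ip \<Omega> p p \<le> ip \<Omega> (dvg \<Omega> v) p \<and> (H1v_norm \<Omega> v)\<^sup>2 \<le> ip \<Omega> p p"
      if "p \<in> Q h" for p
      using stokes_witness[OF V _ \<gamma>(1) \<gamma>(2)[OF h that]] that Q by blast
  qed
  show ?thesis
  proof (cases "H = {}")
    case True
    then show ?thesis using zero_less_one by blast
  next
    case False
    then obtain h0 where "h0 \<in> H" by blast
    \<comment> \<open>The constants depend only on \<open>C\<close>, \<open>c\<close>, \<open>\<gamma>\<close> and the dimension, so any mesh size may be used to name them.\<close>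
    then interpret D: biot_discretization \<Omega> "V h0" "W h0" "Q h0" C c "\<gamma> / 2" by (rule disc)
    show ?thesis
    proof (intro exI conjI allI impI)
      show "D.cont_const > 0" "D.low_const / sqrt D.up_const > 0" using D.const_pos by auto
      fix lam \<mu> \<alpha> M \<mu>f \<tau> h :: real and K :: "real^'d \<Rightarrow> real^'d^'d"
      assume par: "lam \<ge> 0" "\<mu> > 0" "\<alpha> > 0" "M > 0" "\<mu>f > 0" "permeability \<Omega> K" "\<tau> > 0" and h: "h \<in> H"
      interpret Dh: biot_discretization \<Omega> "V h" "W h" "Q h" C c "\<gamma> / 2" by (rule disc[OF h])
      interpret P: biot_problem \<Omega> "V h" "W h" "Q h" C c "\<gamma> / 2" lam \<mu> \<alpha> M \<mu>f \<tau> K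
        using par by unfold_locales
      show "(SUP x \<in> nonzero_states \<Omega> (V h) (W h) (Q h). SUP y \<in> nonzero_states \<Omega> (V h) (W h) (Q h).
         ereal (biot_quotient \<Omega> (Q h) lam \<mu> \<alpha> M \<mu>f K \<tau> x y)) \<le> ereal D.cont_const"
        using P.quotient_le by (auto intro!: SUP_least)
      show "(INF y \<in> nonzero_states \<Omega> (V h) (W h) (Q h). SUP x \<in> nonzero_states \<Omega> (V h) (W h) (Q h).
         ereal (biot_quotient \<Omega> (Q h) lam \<mu> \<alpha> M \<mu>f K \<tau> x y)) \<ge> ereal (D.low_const / sqrt D.up_const)"
      proof (rule INF_greatest)
        fix y assume "y \<in> nonzero_states \<Omega> (V h) (W h) (Q h)"
        from P.quotient_ge[OF this] obtain x where "x \<in> nonzero_states \<Omega> (V h) (W h) (Q h)"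
          "ereal (D.low_const / sqrt D.up_const) \<le> ereal (biot_quotient \<Omega> (Q h) lam \<mu> \<alpha> M \<mu>f K \<tau> x y)"
          by auto
        then show "ereal (D.low_const / sqrt D.up_const)
          \<le> (SUP x \<in> nonzero_states \<Omega> (V h) (W h) (Q h). ereal (biot_quotient \<Omega> (Q h) lam \<mu> \<alpha> M \<mu>f K \<tau> x y))"
          by (rule SUP_upper2)
      qed
    qed
  qed
qed

end
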